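(* Let $K$ be a field and let $\mathcal P$ be a finite poset in which the $2\times3$ grid $\{1,2\}\times\{1,2,3\}$ is embedded. Let $\mathcal R$ be the set of connected spreads in $\mathcal P$ and let $\mathcal X$ be the set of connected spread modules over the incidence algebra $I(\mathcal P)$. Then the generalized rank invariant $\operatorname{rk}(-,\mathcal R)$ is not a dim-hom invariant relative to $\mathcal X$; that is, $\operatorname{rk}(-,\mathcal R)$ is not equivalent to $[M]\mapsto(\dim_K\operatorname{Hom}_{I(\mathcal P)}(R,M))_{R\in\mathcal X}$.
   Context: The grid carries the product order; embedded means that there is an order embedding (injective map $\iota$ with $x\le y\iff\iota(x)\le\iota(y)$) of the grid into $\mathcal P$. Finitely generated $I(\mathcal P)$-modules are identified with functors $M$ from $\mathcal P$ to finite-dimensional $K$-vector spaces. For sets $A,B\subseteq\mathcal P$ of pairwise incomparable elements such that every $a\in A$ is $\le$ some element of $B$ and every $b\in B$ is $\ge$ some element of $A$, the spread from $A$ to $B$ is $[A,B]=\{x\mid\exists a\in A,b\in B:\ a\le x\le b\}$. It is connected if any two of its points are joined by an unoriented path in it in the Hasse quiver of $\mathcal P$. The spread module $M_{[A,B]}$ is $K$ at points of $[A,B]$, $0$ elsewhere, with identity maps between points of $[A,B]$ and zero maps otherwise; it is a connected spread module if $[A,B]$ is connected. For $X\subseteq\mathcal P$ a connected poset in the induced order, $\operatorname{rk}(M,X)$ is the rank of the natural map $\lim M|_X\to\operatorname{colim}M|_X$ (the composite $\lim M|_X\to M(x)\to\operatorname{colim}M|_X$ for any $x\in X$), where $M|_X$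 is the restriction of $M$ to $X$. For a set $\mathcal R$ of such subsets, $\operatorname{rk}(M,\mathcal R)=(\operatorname{rk}(M,X))_{X\in\mathcal R}$. $K_0^{split}(I(\mathcal P))$ is the free abelian group on isomorphism classes of modules modulo $[M\oplus N]=[M]+[N]$. The maps $\operatorname{rk}(-,\mathcal R)$ and $(\dim_K\operatorname{Hom}(R,-))_{R\in\mathcal X}$ are regarded as group homomorphisms on $K_0^{split}(I(\mathcal P))$; two such homomorphisms are equivalent if they have the same kernel. *)

theory Defs
  imports
    "Jordan_Normal_Form.Missing_VectorSpace"
    "HOL-Algebra.Free_Abelian_Groups"
    "HOL-Algebra.QuotRing"
    "HOL-Library.Product_Order"
begin

text \<open>
  Finitely generated modules over the incidence algebra, as functors from the poset to
  finite-dimensional \<open>K\<close>-vector spaces. The map \<open>act M x y\<close> is the value of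
  the functor on \<open>x \<le> y\<close>; it is irrelevant if \<open>\<not> x \<le> y\<close>, and outside of \<open>carrier (obj M x)\<close>.
\<close>

record ('p, 'k, 'v) pmod =
  obj :: "'p \<Rightarrow> ('k, 'v) module"
  act :: "'p \<Rightarrow> 'p \<Rightarrow> 'v \<Rightarrow> 'v"

definition is_pmod :: "'k ring \<Rightarrow> ('p::order, 'k, 'v) pmod \<Rightarrow> bool" where
  "is_pmod K M \<longleftrightarrow>
     (\<forall>x. vectorspace K (obj M x) \<and> vectorspace.fin_dim K (obj M x)) \<and>
     (\<forall>x y. x \<le> y \<longrightarrow> act M x y \<in> module_hom K (obj M x) (obj M y)) \<and>
     (\<forall>x. \<forall>v\<in>carrier (obj M x). act M x x v = v) \<and>
     (\<forall>x y z. x \<le> y \<and> y \<le> z \<longrightarrow>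
        (\<forall>v\<in>carrier (obj M x). act M x z v = act M y z (act M x y v)))"

text \<open>
  Natural transformations. Their components are made extensional, so that equality of functions is
  equality of natural transformations.
\<close>

definition nat_trans ::
  "'k ring \<Rightarrow> ('p::order, 'k, 'v) pmod \<Rightarrow> ('p, 'k, 'w) pmod \<Rightarrow> ('p \<Rightarrow> 'v \<Rightarrow> 'w) set" where
  "nat_trans K M N =
     {\<eta>. (\<forall>x. \<eta> x \<in> module_hom K (obj M x) (obj N x) \<inter> extensional (carrier (obj M x))) \<and>
         (\<forall>x y. x \<le> y \<longrightarrow>
            (\<forall>v\<in>carrier (obj M x). \<eta> y (act M x y v) = act N x y (\<eta> x v)))}"

text \<open>The components \<open>mult\<close> and \<open>one\<close> play no role for vector spaces.\<close>

definition Hom ::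
  "'k ring \<Rightarrow> ('p::order, 'k, 'v) pmod \<Rightarrow> ('p, 'k, 'w) pmod \<Rightarrow> ('k, 'p \<Rightarrow> 'v \<Rightarrow> 'w) module" where
  "Hom K M N =
     \<lparr>carrier = nat_trans K M N,
      monoid.mult = undefined,
      one = undefined,
      ring.zero = (\<lambda>x. \<lambda>v\<in>carrier (obj M x). \<zero>\<^bsub>obj N x\<^esub>),
      add = (\<lambda>\<eta> \<theta> x. \<lambda>v\<in>carrier (obj M x). \<eta> x v \<oplus>\<^bsub>obj N x\<^esub> \<theta> x v),
      smult = (\<lambda>c \<eta> x. \<lambda>v\<in>carrier (obj M x). c \<odot>\<^bsub>obj N x\<^esub> \<eta> x v)\<rparr>"

definition dim_Hom ::
  "'k ring \<Rightarrow> ('p::order, 'k, 'v) pmod \<Rightarrow> ('p, 'k, 'w) pmod \<Rightarrow> nat" where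
  "dim_Hom K M N = vectorspace.dim K (Hom K M N)"

definition pmod_iso ::
  "'k ring \<Rightarrow> ('p::order, 'k, 'v) pmod \<Rightarrow> ('p, 'k, 'w) pmod \<Rightarrow> bool" where
  "pmod_iso K M N \<longleftrightarrow>
     (\<exists>\<eta>\<in>nat_trans K M N. \<forall>x. bij_betw (\<eta> x) (carrier (obj M x)) (carrier (obj N x)))"

definition pmod_sum ::
  "('p, 'k, 'v) pmod \<Rightarrow> ('p, 'k, 'w) pmod \<Rightarrow> ('p, 'k, 'v \<times> 'w) pmod" where
  "pmod_sum M N =
     \<lparr>obj = (\<lambda>x. direct_sum (obj M x) (obj N x)),
      act = (\<lambda>x y. map_prod (act M x y) (act N x y))\<rparr>"

definition covers :: "'p::order \<Rightarrow> 'p \<Rightarrow> bool" where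
  "covers x y \<longleftrightarrow> x < y \<and> \<not> (\<exists>z. x < z \<and> z < y)"

definition antichain :: "'p::order set \<Rightarrow> bool" where
  "antichain A \<longleftrightarrow> (\<forall>a\<in>A. \<forall>b\<in>A. a \<le> b \<longrightarrow> a = b)"

definition spread :: "'p::order set \<Rightarrow> 'p set \<Rightarrow> 'p set" where
  "spread A B = {x. \<exists>a\<in>A. \<exists>b\<in>B. a \<le> x \<and> x \<le> b}"

definition is_spread :: "'p::order set \<Rightarrow> bool" where
  "is_spread S \<longleftrightarrow>
     (\<exists>A B. antichain A \<and> antichain B \<and>
        (\<forall>a\<in>A. \<exists>b\<in>B. a \<le> b) \<and> (\<forall>b\<in>B. \<exists>a\<in>A. a \<le> b) \<and> S = spread A B)"

text \<open>
  Any two points are joined by an unoriented path of the Hasse quiver that stays inside the set.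
  As usual, a connected set is nonempty.
\<close>

definition hasse_connected :: "'p::order set \<Rightarrow> bool" where
  "hasse_connected S \<longleftrightarrow>
     S \<noteq> {} \<and>
     (\<forall>x\<in>S. \<forall>y\<in>S. (x, y) \<in> {(u, v). u \<in> S \<and> v \<in> S \<and> (covers u v \<or> covers v u)}\<^sup>*)"

definition connected_spreads :: "'p::order set set" where
  "connected_spreads = {S. is_spread S \<and> hasse_connected S}"

text \<open>The spread module of \<open>S\<close> takes its values in the \<open>K\<close>-spaces \<open>K\<close> and \<open>{0}\<close>.\<close>

definition spread_module :: "'k ring \<Rightarrow> 'p::order set \<Rightarrow> ('p, 'k, 'k) pmod" where
  "spread_module K S =
     \<lparr>obj = (\<lambda>x. \<lparr>carrier = (if x \<in> S then carrier K else {\<zero>\<^bsub>K\<^esub>}),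
                  monoid.mult = monoid.mult K, one = one K, ring.zero = ring.zero K, add = add K, smult = monoid.mult K\<rparr>),
      act = (\<lambda>x y v. if x \<in> S \<and> y \<in> S then v else \<zero>\<^bsub>K\<^esub>)\<rparr>"

definition connected_spread_modules :: "'k ring \<Rightarrow> ('p::order, 'k, 'k) pmod set" where
  "connected_spread_modules K = spread_module K ` connected_spreads"

definition quotient_space ::
  "('k, 'v) module \<Rightarrow> 'v set \<Rightarrow> ('k, 'v set) module" where
  "quotient_space V W =
     \<lparr>carrier = a_rcosets\<^bsub>V\<^esub> W,
      monoid.mult = undefined,
      one = undefined,
      ring.zero = W,
      add = set_add V,
      smult = (\<lambda>c C. \<Union>v\<in>C. W +>\<^bsub>V\<^esub> (c \<odot>\<^bsub>V\<^esub> v))\<rparr>"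

text \<open>The product of the spaces \<open>M(x)\<close>, \<open>x \<in> X\<close>; it is their direct sum as well, \<open>X\<close> being finite.\<close>

definition family_space :: "('p, 'k, 'v) pmod \<Rightarrow> 'p set \<Rightarrow> ('k, 'p \<Rightarrow> 'v) module" where
  "family_space M X =
     \<lparr>carrier = (\<Pi>\<^sub>E x\<in>X. carrier (obj M x)),
      monoid.mult = undefined,
      one = undefined,
      ring.zero = (\<lambda>x\<in>X. \<zero>\<^bsub>obj M x\<^esub>),
      add = (\<lambda>s t. \<lambda>x\<in>X. s x \<oplus>\<^bsub>obj M x\<^esub> t x),
      smult = (\<lambda>c s. \<lambda>x\<in>X. c \<odot>\<^bsub>obj M x\<^esub> s x)\<rparr>"

definition lim_space :: "('p::order, 'k, 'v) pmod \<Rightarrow> 'p set \<Rightarrow> ('k, 'p \<Rightarrow> 'v) module" where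
  "lim_space M X =
     (family_space M X)
       \<lparr>carrier := {s \<in> carrier (family_space M X).
                      \<forall>x\<in>X. \<forall>y\<in>X. x \<le> y \<longrightarrow> act M x y (s x) = s y}\<rparr>"

definition family_inj :: "('p, 'k, 'v) pmod \<Rightarrow> 'p set \<Rightarrow> 'p \<Rightarrow> 'v \<Rightarrow> 'p \<Rightarrow> 'v" where
  "family_inj M X x v = (\<lambda>y\<in>X. if y = x then v else \<zero>\<^bsub>obj M y\<^esub>)"

definition colim_relations ::
  "'k ring \<Rightarrow> ('p::order, 'k, 'v) pmod \<Rightarrow> 'p set \<Rightarrow> ('p \<Rightarrow> 'v) set" where
  "colim_relations K M X =
     module.span K (family_space M X)
       {family_inj M X x v \<ominus>\<^bsub>family_space M X\<^esub> family_inj M X y (act M x y v) | x y v.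
          x \<in> X \<and> y \<in> X \<and> x \<le> y \<and> v \<in> carrier (obj M x)}"

definition colim_space ::
  "'k ring \<Rightarrow> ('p::order, 'k, 'v) pmod \<Rightarrow> 'p set \<Rightarrow> ('k, ('p \<Rightarrow> 'v) set) module" where
  "colim_space K M X = quotient_space (family_space M X) (colim_relations K M X)"

definition colim_inj ::
  "'k ring \<Rightarrow> ('p::order, 'k, 'v) pmod \<Rightarrow> 'p set \<Rightarrow> 'p \<Rightarrow> 'v \<Rightarrow> ('p \<Rightarrow> 'v) set" where
  "colim_inj K M X x v = colim_relations K M X +>\<^bsub>family_space M X\<^esub> family_inj M X x v"

text \<open>For connected \<open>X\<close> the composite through \<open>M(x)\<close> does not depend on the choice of \<open>x \<in> X\<close>.\<close>

definition lim_to_colim ::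
  "'k ring \<Rightarrow> ('p::order, 'k, 'v) pmod \<Rightarrow> 'p set \<Rightarrow> ('p \<Rightarrow> 'v) \<Rightarrow> ('p \<Rightarrow> 'v) set" where
  "lim_to_colim K M X s = (let x = (SOME x. x \<in> X) in colim_inj K M X x (s x))"

definition map_rank ::
  "'k ring \<Rightarrow> ('k, 'v) module \<Rightarrow> ('k, 'w) module \<Rightarrow> ('v \<Rightarrow> 'w) \<Rightarrow> nat" where
  "map_rank K V W T = vectorspace.dim K (W\<lparr>carrier := T ` carrier V\<rparr>)"

definition rk :: "'k ring \<Rightarrow> ('p::order, 'k, 'v) pmod \<Rightarrow> 'p set \<Rightarrow> nat" where
  "rk K M X = map_rank K (lim_space M X) (colim_space K M X) (lim_to_colim K M X)"

text \<open>
  Modules with values in spaces whose vectors are of type \<open>nat \<Rightarrow> 'k\<close>. All finite-dimensional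
  \<open>K\<close>-vector spaces are isomorphic to such spaces, so every isomorphism class of modules has
  representatives here. \<open>iso_class K M\<close> consists of the representatives of the class of \<open>M\<close>,
  where \<open>M\<close> itself may have vectors of another type, as direct sums do.
\<close>

type_synonym ('p, 'k) umod = "('p, 'k, nat \<Rightarrow> 'k) pmod"

definition iso_class :: "'k ring \<Rightarrow> ('p::order, 'k, 'v) pmod \<Rightarrow> ('p, 'k) umod set" where
  "iso_class K M = {L. is_pmod K L \<and> pmod_iso K L M}"

definition iso_classes :: "'k ring \<Rightarrow> ('p::order, 'k) umod set set" where
  "iso_classes K = iso_class K ` {M :: ('p, 'k) umod. is_pmod K M}"

definition split_relations :: "'k ring \<Rightarrow> (('p::order, 'k) umod set \<Rightarrow>\<^sub>0 int) set" where
  "split_relations K =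
     {frag_of (iso_class K (pmod_sum M N)) - (frag_of (iso_class K M) + frag_of (iso_class K N)) |
        (M :: ('p, 'k) umod) (N :: ('p, 'k) umod). is_pmod K M \<and> is_pmod K N}"

definition K0_split :: "'k ring \<Rightarrow> (('p::order, 'k) umod set \<Rightarrow>\<^sub>0 int) set monoid" where
  "K0_split K =
     free_Abelian_group (iso_classes K) Mod
       generate (free_Abelian_group (iso_classes K)) (split_relations K)"

text \<open>
  A family \<open>f\<close> of numerical invariants, indexed by \<open>I\<close>, that are constant on isomorphism classes and
  additive on direct sums extends linearly to the free abelian group and descends to the quotient:
  \<open>the_elem\<close> picks the common value on all representatives, as for the map induced on
  \<open>G Mod kernel G H h\<close> in \<^theory>\<open>HOL-Algebra.Coset\<close>.
\<close>

definition free_extension ::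
  "'i set \<Rightarrow> (('p, 'k) umod \<Rightarrow> 'i \<Rightarrow> nat) \<Rightarrow> (('p, 'k) umod set \<Rightarrow>\<^sub>0 int) \<Rightarrow> 'i \<Rightarrow> int" where
  "free_extension I f a =
     (\<lambda>i\<in>I. \<Sum>c\<in>Poly_Mapping.keys a.
        Poly_Mapping.lookup a c * int (the_elem ((\<lambda>M. f M i) ` c)))"

definition K0_hom ::
  "'i set \<Rightarrow> (('p, 'k) umod \<Rightarrow> 'i \<Rightarrow> nat) \<Rightarrow> (('p, 'k) umod set \<Rightarrow>\<^sub>0 int) set \<Rightarrow> 'i \<Rightarrow> int" where
  "K0_hom I f C = the_elem (free_extension I f ` C)"

definition K0_kernel ::
  "'k ring \<Rightarrow> 'i set \<Rightarrow> (('p::order, 'k) umod \<Rightarrow> 'i \<Rightarrow> nat) \<Rightarrow>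
     (('p, 'k) umod set \<Rightarrow>\<^sub>0 int) set set" where
  "K0_kernel K I f = kernel (K0_split K) (product_group I (\<lambda>_. integer_group)) (K0_hom I f)"

definition equivalent_invariants ::
  "'k ring \<Rightarrow> 'i set \<Rightarrow> (('p::order, 'k) umod \<Rightarrow> 'i \<Rightarrow> nat) \<Rightarrow>
     'j set \<Rightarrow> (('p, 'k) umod \<Rightarrow> 'j \<Rightarrow> nat) \<Rightarrow> bool" where
  "equivalent_invariants K I f J g \<longleftrightarrow> K0_kernel K I f = K0_kernel K J g"

definition dim_hom_invariant ::
  "'k ring \<Rightarrow> ('p::order, 'k, 'v) pmod set \<Rightarrow> 'i set \<Rightarrow> (('p, 'k) umod \<Rightarrow> 'i \<Rightarrow> nat) \<Rightarrow> bool" where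
  "dim_hom_invariant K \<X> I f \<longleftrightarrow> equivalent_invariants K I f \<X> (\<lambda>M R. dim_Hom K R M)"

text \<open>The order on pairs is the product order of \<^theory>\<open>HOL-Library.Product_Order\<close>.\<close>

definition order_embedding_on :: "'a::order set \<Rightarrow> ('a \<Rightarrow> 'p::order) \<Rightarrow> bool" where
  "order_embedding_on G \<iota> \<longleftrightarrow>
     inj_on \<iota> G \<and> (\<forall>x\<in>G. \<forall>y\<in>G. x \<le> y \<longleftrightarrow> \<iota> x \<le> \<iota> y)"

definition grid_2_3 :: "(nat \<times> nat) set" where
  "grid_2_3 = {1, 2} \<times> {1, 2, 3}"

end

theory Submission
  imports Defs
begin

text \<open>
  The grid enters through four of its points: \<open>p < q\<close> and two incomparable points
  \<open>u, v\<close> above \<open>q\<close>, a \<^emph>\<open>fork\<close>. Let \<open>A\<close> consist of the points above \<open>p\<close> that are not above \<open>v\<close>,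
  and \<open>B\<close> of those not above \<open>u\<close>; let \<open>C = A \<inter> B\<close> and \<open>S = C - {p}\<close>. These sets are convex, and
  \<open>p\<close> is the least point of \<open>A\<close>, \<open>B\<close> and \<open>C\<close>. Let \<open>G\<close> be the submodule of
  \<open>M\<^bsub>A\<^esub> \<oplus> M\<^bsub>B\<^esub>\<close> that is the diagonal at \<open>p\<close> and everything elsewhere. The class
  \<open>[G] + [M\<^bsub>C\<^esub>] - [M\<^bsub>A\<^esub>] - [M\<^bsub>B\<^esub>] - [M\<^bsub>S\<^esub>]\<close> is killed by the rank invariant, but not by
  \<open>dim Hom(M\<^bsub>C\<^esub>, -)\<close>.

  For the ranks (\<open>rk_identity\<close>), let \<open>X\<close> be a connected spread. If \<open>p\<close> is not in \<open>X\<close>, then on \<open>X\<close> the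
  module \<open>G\<close> agrees with \<open>M\<^bsub>A\<^esub> \<oplus> M\<^bsub>B\<^esub>\<close>, and \<open>C\<close> with \<open>S\<close>. Let \<open>p \<in> X\<close>. The rank over \<open>X\<close> of a module
  that vanishes at some point of \<open>X\<close> is zero; in particular this holds for \<open>M\<^bsub>S\<^esub>\<close>. If \<open>X \<subseteq> A\<close>, then on \<open>X\<close>
  the module \<open>G\<close> splits as the direct sum of \<open>M\<^bsub>A\<^esub>\<close> and a module that vanishes at \<open>p\<close>, while \<open>B\<close> and \<open>C\<close>
  have the same points in \<open>X\<close>; the case \<open>X \<subseteq> B\<close> is symmetric. In the remaining case, \<open>A\<close>, \<open>B\<close>
  and \<open>C\<close> all miss points of \<open>X\<close>, and the rank of \<open>G\<close> is zero too: either \<open>G\<close> vanishes somewhere on \<open>X\<close>, or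
  convexity puts \<open>q\<close>, \<open>u\<close> and \<open>v\<close> into \<open>X\<close>, and a vector \<open>(c, c)\<close> at \<open>p\<close> becomes \<open>(c, 0) + (0, c)\<close>
  at \<open>q\<close>, where the first summand dies at \<open>v\<close> and the second at \<open>u\<close>.

  For the homomorphisms (\<open>dim_Hom_C\<close>), a map out of \<open>M\<^bsub>C\<^esub>\<close> is determined by the image of \<open>1\<close> at \<open>p\<close>, which
  must die at \<open>u\<close> and at \<open>v\<close>. This forces it to be zero in \<open>M\<^bsub>A\<^esub>\<close>, \<open>M\<^bsub>B\<^esub>\<close> and \<open>G\<close>; in \<open>M\<^bsub>S\<^esub>\<close> it is zero
  because \<open>p \<notin> S\<close>. But \<open>M\<^bsub>C\<^esub>\<close> has its identity.

  The passage to \<open>K\<^sub>0\<close> needs both invariants to be constant on isomorphism classes and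
  additive on direct sums. Each is expressed through dimensions of subspaces of products
  of the spaces \<open>M(x)\<close>: the rank is the dimension of the limit minus that of the kernel of
  the map to the colimit (\<open>rk_eq_dims\<close>), and \<open>Hom(M\<^bsub>Y\<^esub>, M)\<close> is the space of those sections
  over a convex set \<open>Y\<close> that die outside \<open>Y\<close> (\<open>dim_Hom_spread_module\<close>). All these subspaces are preserved by natural
  maps, and for such subspaces invariance and additivity of the dimension hold in general
  (\<open>subspace_dim_iso\<close>, \<open>subspace_dim_sum\<close>).
\<close>

section \<open>Linear algebra\<close>

text \<open>
  All axioms of a vector space are equations (the negative of \<open>f v\<close> being \<open>f (- v)\<close>), hence they pass
  to surjective images. This spares a separate verification of the axioms for quotients,
  spaces of homomorphisms and transported spaces.
\<close>

lemma surjective_hom_vectorspace: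
  assumes V: "vectorspace K V"
    and img: "f ` carrier V = carrier W"
    and zero: "f \<zero>\<^bsub>V\<^esub> = \<zero>\<^bsub>W\<^esub>"
    and add: "\<And>v w. v \<in> carrier V \<Longrightarrow> w \<in> carrier V \<Longrightarrow> f (v \<oplus>\<^bsub>V\<^esub> w) = f v \<oplus>\<^bsub>W\<^esub> f w"
    and smult: "\<And>c v. c \<in> carrier K \<Longrightarrow> v \<in> carrier V \<Longrightarrow> f (c \<odot>\<^bsub>V\<^esub> v) = c \<odot>\<^bsub>W\<^esub> f v"
  shows "vectorspace K W" and "linear_map K V W f"
proof -
  interpret V: vectorspace K V by (rule V)
  have ball: "(\<forall>w\<in>carrier W. P w) \<longleftrightarrow> (\<forall>v\<in>carrier V. P (f v))" for P
    unfolding img[symmetric] by simp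
  have [simp]: "f v \<in> carrier W" if "v \<in> carrier V" for v
    using that img by auto
  show W: "vectorspace K W"
  proof (rule vs_criteria)
    show "field K" by unfold_locales
    show "\<zero>\<^bsub>W\<^esub> \<in> carrier W" using zero by (metis V.M.zero_closed \<open>\<And>v. v \<in> carrier V \<Longrightarrow> f v \<in> carrier W\<close>)
    have "\<forall>v\<in>carrier W. \<forall>w\<in>carrier W. v \<oplus>\<^bsub>W\<^esub> w \<in> carrier W"
      unfolding ball by (simp flip: add)
    then show "\<forall>v w. v \<in> carrier W \<and> w \<in> carrier W \<longrightarrow> v \<oplus>\<^bsub>W\<^esub> w \<in> carrier W" by blast
    show "\<forall>v\<in>carrier W. \<exists>neg_v\<in>carrier W. v \<oplus>\<^bsub>W\<^esub> neg_v = \<zero>\<^bsub>W\<^esub>"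
      unfolding ball
    proof
      fix v assume v: "v \<in> carrier V"
      have "f v \<oplus>\<^bsub>W\<^esub> f (\<ominus>\<^bsub>V\<^esub> v) = \<zero>\<^bsub>W\<^esub>"
        using v by (simp add: V.M.r_neg zero flip: add)
      then show "\<exists>neg_v\<in>carrier W. f v \<oplus>\<^bsub>W\<^esub> neg_v = \<zero>\<^bsub>W\<^esub>" using v by force
    qed
    have "\<forall>c\<in>carrier K. \<forall>w\<in>carrier W. c \<odot>\<^bsub>W\<^esub> w \<in> carrier W"
      unfolding ball by (simp flip: smult)
    then show "\<forall>c v. c \<in> carrier K \<and> v \<in> carrier W \<longrightarrow> c \<odot>\<^bsub>W\<^esub> v \<in> carrier W" by blast
    have "\<forall>v\<in>carrier W. \<forall>w\<in>carrier W. v \<oplus>\<^bsub>W\<^esub> w = w \<oplus>\<^bsub>W\<^esub> v"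
      unfolding ball by (simp add: V.M.a_comm flip: add)
    then show "\<forall>v w. v \<in> carrier W \<and> w \<in> carrier W \<longrightarrow> v \<oplus>\<^bsub>W\<^esub> w = w \<oplus>\<^bsub>W\<^esub> v" by blast
    have "\<forall>v\<in>carrier W. \<forall>w\<in>carrier W. \<forall>x\<in>carrier W. (v \<oplus>\<^bsub>W\<^esub> w) \<oplus>\<^bsub>W\<^esub> x = v \<oplus>\<^bsub>W\<^esub> (w \<oplus>\<^bsub>W\<^esub> x)"
      unfolding ball by (simp add: V.M.a_assoc flip: add)
    then show "\<forall>v w x. v \<in> carrier W \<and> w \<in> carrier W \<and> x \<in> carrier W \<longrightarrow>
        v \<oplus>\<^bsub>W\<^esub> w \<oplus>\<^bsub>W\<^esub> x = v \<oplus>\<^bsub>W\<^esub> (w \<oplus>\<^bsub>W\<^esub> x)" by blast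
    have "\<forall>v\<in>carrier W. v \<oplus>\<^bsub>W\<^esub> \<zero>\<^bsub>W\<^esub> = v"
      unfolding ball zero[symmetric] by (simp flip: add)
    then show "\<forall>v\<in>carrier W. v \<oplus>\<^bsub>W\<^esub> \<zero>\<^bsub>W\<^esub> = v" .
    have "\<forall>v\<in>carrier W. \<forall>a\<in>carrier K. \<forall>b\<in>carrier K. (a \<otimes>\<^bsub>K\<^esub> b) \<odot>\<^bsub>W\<^esub> v = a \<odot>\<^bsub>W\<^esub> (b \<odot>\<^bsub>W\<^esub> v)"
      unfolding ball by (simp add: V.smult_assoc1 flip: smult)
    then show "\<forall>a b v. a \<in> carrier K \<and> b \<in> carrier K \<and> v \<in> carrier W \<longrightarrow>
        (a \<otimes>\<^bsub>K\<^esub> b) \<odot>\<^bsub>W\<^esub> v = a \<odot>\<^bsub>W\<^esub> (b \<odot>\<^bsub>W\<^esub> v)" by blast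
    show "\<forall>v\<in>carrier W. \<one>\<^bsub>K\<^esub> \<odot>\<^bsub>W\<^esub> v = v"
      unfolding ball by (simp flip: smult)
    have "\<forall>v\<in>carrier W. \<forall>a\<in>carrier K. \<forall>b\<in>carrier K. (a \<oplus>\<^bsub>K\<^esub> b) \<odot>\<^bsub>W\<^esub> v = a \<odot>\<^bsub>W\<^esub> v \<oplus>\<^bsub>W\<^esub> b \<odot>\<^bsub>W\<^esub> v"
      unfolding ball by (simp add: V.smult_l_distr flip: smult add)
    then show "\<forall>a b v. a \<in> carrier K \<and> b \<in> carrier K \<and> v \<in> carrier W \<longrightarrow>
        (a \<oplus>\<^bsub>K\<^esub> b) \<odot>\<^bsub>W\<^esub> v = a \<odot>\<^bsub>W\<^esub> v \<oplus>\<^bsub>W\<^esub> b \<odot>\<^bsub>W\<^esub> v" by blast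
    have "\<forall>v\<in>carrier W. \<forall>w\<in>carrier W. \<forall>a\<in>carrier K. a \<odot>\<^bsub>W\<^esub> (v \<oplus>\<^bsub>W\<^esub> w) = a \<odot>\<^bsub>W\<^esub> v \<oplus>\<^bsub>W\<^esub> a \<odot>\<^bsub>W\<^esub> w"
      unfolding ball by (simp add: V.smult_r_distr flip: smult add)
    then show "\<forall>a v w. a \<in> carrier K \<and> v \<in> carrier W \<and> w \<in> carrier W \<longrightarrow>
        a \<odot>\<^bsub>W\<^esub> (v \<oplus>\<^bsub>W\<^esub> w) = a \<odot>\<^bsub>W\<^esub> v \<oplus>\<^bsub>W\<^esub> a \<odot>\<^bsub>W\<^esub> w" by blast
  qed
  then show "linear_map K V W f"
    using V add smult
    by (auto simp: linear_map_def vectorspace_def mod_hom_def mod_hom_axioms_def module_hom_def)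
qed

lemma linear_mapI:
  assumes "vectorspace K V" "vectorspace K W" "f \<in> module_hom K V W"
  shows "linear_map K V W f"
  using assms by (auto simp: linear_map_def vectorspace_def mod_hom_def mod_hom_axioms_def)

text \<open>
  The preimage of a submodule is a submodule, so it contains a span as soon as it contains the
  generators.
\<close>

lemma hom_image_span_subset:
  assumes f: "linear_map K V W f" and N: "submodule K N W"
    and A: "A \<subseteq> carrier V" and fA: "f ` A \<subseteq> N"
  shows "f ` module.span K V A \<subseteq> N"
proof -
  interpret V: vectorspace K V using f by (simp add: linear_map_def)
  interpret linear_map K V W f by (rule f)
  interpret N: submodule K N W by (rule N)
  have "submodule K {v \<in> carrier V. f v \<in> N} V"
    by unfold_locales auto
  then have "V.span A \<subseteq> {v \<in> carrier V. f v \<in> N}"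
    using A fA by (intro V.span_is_subset) auto
  then show ?thesis by auto
qed

lemma subspaceI:
  assumes "vectorspace K V" "N \<subseteq> carrier V" "\<zero>\<^bsub>V\<^esub> \<in> N"
    "\<And>v w. v \<in> N \<Longrightarrow> w \<in> N \<Longrightarrow> v \<oplus>\<^bsub>V\<^esub> w \<in> N"
    "\<And>c v. c \<in> carrier K \<Longrightarrow> v \<in> N \<Longrightarrow> c \<odot>\<^bsub>V\<^esub> v \<in> N"
  shows "subspace K N V"
  using assms by (auto simp: subspace_def submodule_def vectorspace_def)

text \<open>
  Independent subsets of the subspace are independent in the whole space, which bounds their
  size; a maximal one is therefore finite, and it generates.
\<close>

lemma subspace_fin_dim:
  assumes N: "subspace K N V" and fd: "vectorspace.fin_dim K V"
  shows "vectorspace K (V\<lparr>carrier := N\<rparr>)" and "vectorspace.fin_dim K (V\<lparr>carrier := N\<rparr>)"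
proof -
  interpret V: vectorspace K V using N by (simp add: subspace_def)
  have sub: "submodule K N V" using N by (simp add: subspace_def)
  show W: "vectorspace K (V\<lparr>carrier := N\<rparr>)" by (rule V.subspace_is_vs[OF N])
  interpret W: vectorspace K "V\<lparr>carrier := N\<rparr>" by (rule W)
  let ?P = "\<lambda>S. S \<subseteq> carrier (V\<lparr>carrier := N\<rparr>) \<and> W.lin_indpt S"
  have "\<exists>A. finite A \<and> maximal A ?P"
  proof (rule maximal_exists)
    fix A assume A: "?P A"
    then have "V.lin_indpt A" "A \<subseteq> carrier V"
      using V.span_li_not_depend(2)[of A N, OF _ sub] submodule.subset[OF sub] by auto
    then show "finite A \<and> card A \<le> V.dim" using V.li_le_dim[OF fd] by auto
  next
    show "?P {}" by (simp add: W.lin_dep_def)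
  qed
  then obtain A where A: "finite A" "maximal A ?P" by blast
  then show "W.fin_dim"
    unfolding W.fin_dim_def using W.max_li_is_gen[OF A(2)] by (auto simp: maximal_def)
qed

lemma direct_sum_simps [simp]:
  "carrier (direct_sum V W) = carrier V \<times> carrier W"
  "\<zero>\<^bsub>direct_sum V W\<^esub> = (\<zero>\<^bsub>V\<^esub>, \<zero>\<^bsub>W\<^esub>)"
  "v \<oplus>\<^bsub>direct_sum V W\<^esub> w = (fst v \<oplus>\<^bsub>V\<^esub> fst w, snd v \<oplus>\<^bsub>W\<^esub> snd w)"
  "c \<odot>\<^bsub>direct_sum V W\<^esub> v = (c \<odot>\<^bsub>V\<^esub> fst v, c \<odot>\<^bsub>W\<^esub> snd v)"
  by (simp_all add: direct_sum_def)

lemma linear_bij_dim: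
  assumes f: "linear_map K V W f" and bij: "bij_betw f (carrier V) (carrier W)"
    and fd: "vectorspace.fin_dim K V"
  shows "vectorspace.fin_dim K W" and "vectorspace.dim K W = vectorspace.dim K V"
proof -
  interpret linear_map K V W f by (rule f)
  show "W.fin_dim" using bij rank_nullity_main(2)[OF fd] by (simp add: bij_betw_def)
  show "W.dim = V.dim" using bij dim_eq[OF fd] by (simp add: bij_betw_def)
qed

lemma dim_eq_0_iff:
  assumes "vectorspace K V" "vectorspace.fin_dim K V"
  shows "vectorspace.dim K V = 0 \<longleftrightarrow> carrier V = {\<zero>\<^bsub>V\<^esub>}"
proof -
  interpret V: vectorspace K V by fact
  obtain B where B: "finite B" "V.basis B" using V.finite_basis_exists assms(2) by blast
  have d: "V.dim = card B" using B by (rule V.dim_basis)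
  show ?thesis
  proof
    assume "V.dim = 0"
    then have "B = {}" using d B by simp
    then show "carrier V = {\<zero>\<^bsub>V\<^esub>}" using B V.span_empty by (auto simp: V.basis_def)
  next
    assume *: "carrier V = {\<zero>\<^bsub>V\<^esub>}"
    then have "V.dim \<le> card {}" using V.span_empty V.gen_ge_dim[of "{}"] by simp
    then show "V.dim = 0" by simp
  qed
qed

text \<open>
  Generators of the two summands together generate the sum; the dimension formula is rank-nullity
  for the first projection.
\<close>

lemma direct_sum_fin_dim:
  assumes V: "vectorspace K V" "vectorspace.fin_dim K V"
    and W: "vectorspace K W" "vectorspace.fin_dim K W"
  shows "vectorspace.fin_dim K (direct_sum V W)"
    and "vectorspace.dim K (direct_sum V W) = vectorspace.dim K V + vectorspace.dim K W"
proof -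
  interpret V: vectorspace K V by fact
  interpret W: vectorspace K W by fact
  have vs: "vectorspace K (direct_sum V W)" using V W by (intro direct_sum_is_vs)
  interpret D: vectorspace K "direct_sum V W" by (rule vs)
  have l1: "linear_map K V (direct_sum V W) (\<lambda>v. (v, \<zero>\<^bsub>W\<^esub>))"
    by (rule linear_mapI[OF V(1) vs]) (auto simp: module_hom_def)
  have l2: "linear_map K W (direct_sum V W) (\<lambda>w. (\<zero>\<^bsub>V\<^esub>, w))"
    by (rule linear_mapI[OF W(1) vs]) (auto simp: module_hom_def)
  obtain A where A: "finite A" "A \<subseteq> carrier V" "V.span A = carrier V"
    using V(2) by (auto simp: V.fin_dim_def)
  obtain B where B: "finite B" "B \<subseteq> carrier W" "W.span B = carrier W"
    using W(2) by (auto simp: W.fin_dim_def)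
  let ?G = "(\<lambda>v. (v, \<zero>\<^bsub>W\<^esub>)) ` A \<union> (\<lambda>w. (\<zero>\<^bsub>V\<^esub>, w)) ` B"
  have G: "?G \<subseteq> carrier (direct_sum V W)" using A B by auto
  have sG: "submodule K (D.span ?G) (direct_sum V W)" by (rule D.span_is_submodule[OF G])
  have 1: "(\<lambda>v. (v, \<zero>\<^bsub>W\<^esub>)) ` V.span A \<subseteq> D.span ?G"
    by (rule hom_image_span_subset[OF l1 sG A(2)]) (use D.in_own_span[OF G] in auto)
  have 2: "(\<lambda>w. (\<zero>\<^bsub>V\<^esub>, w)) ` W.span B \<subseteq> D.span ?G"
    by (rule hom_image_span_subset[OF l2 sG B(2)]) (use D.in_own_span[OF G] in auto)
  have "carrier (direct_sum V W) \<subseteq> D.span ?G"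
  proof
    fix p assume "p \<in> carrier (direct_sum V W)"
    then obtain v w where p: "p = (v, w)" "v \<in> carrier V" "w \<in> carrier W" by auto
    then have "(v, \<zero>\<^bsub>W\<^esub>) \<oplus>\<^bsub>direct_sum V W\<^esub> (\<zero>\<^bsub>V\<^esub>, w) \<in> D.span ?G"
      using 1 2 A B by (intro submodule.m_closed[OF sG]) auto
    then show "p \<in> D.span ?G" using p by simp
  qed
  then have "D.gen_set ?G" using D.span_is_subset2[OF G] by blast
  moreover have "finite ?G" using A(1) B(1) by simp
  ultimately show fd: "D.fin_dim" unfolding D.fin_dim_def using G by (intro exI[of _ ?G] conjI)
  have lf: "linear_map K (direct_sum V W) V fst"
    by (rule linear_mapI[OF vs V(1)]) (auto simp: module_hom_def)
  interpret F: linear_map K "direct_sum V W" V fst by (rule lf)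
  have im: "F.im = carrier V" unfolding F.im_def using W.M.zero_closed by force
  have ker: "F.ker = {\<zero>\<^bsub>V\<^esub>} \<times> carrier W" unfolding F.ker_def by auto
  have kvs: "vectorspace K ((direct_sum V W)\<lparr>carrier := F.ker\<rparr>)"
    using D.subspace_is_vs F.kerT_is_subspace by blast
  have "linear_map K W ((direct_sum V W)\<lparr>carrier := F.ker\<rparr>) (\<lambda>w. (\<zero>\<^bsub>V\<^esub>, w))"
    by (rule linear_mapI[OF W(1) kvs]) (auto simp: module_hom_def ker)
  then have "vectorspace.dim K ((direct_sum V W)\<lparr>carrier := F.ker\<rparr>) = W.dim"
    by (rule linear_bij_dim(2)[OF _ _ W(2)]) (auto simp: bij_betw_def inj_on_def ker)
  then show "D.dim = V.dim + W.dim" using F.rank_nullity[OF fd] im by simp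
qed

lemma is_pmodD:
  assumes "is_pmod K M"
  shows "vectorspace K (obj M x)" "vectorspace.fin_dim K (obj M x)"
    and "x \<le> y \<Longrightarrow> act M x y \<in> module_hom K (obj M x) (obj M y)"
    and "v \<in> carrier (obj M x) \<Longrightarrow> act M x x v = v"
    and "x \<le> y \<Longrightarrow> y \<le> z \<Longrightarrow> v \<in> carrier (obj M x) \<Longrightarrow> act M x z v = act M y z (act M x y v)"
  using assms by (auto simp: is_pmod_def)

lemma is_pmod_field: "is_pmod K M \<Longrightarrow> field K"
  using is_pmodD(1) by (auto simp: vectorspace_def)

lemma is_pmod_act_closed:
  "is_pmod K M \<Longrightarrow> x \<le> y \<Longrightarrow> v \<in> carrier (obj M x) \<Longrightarrow> act M x y v \<in> carrier (obj M y)"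
  using is_pmodD(3) by (fastforce simp: module_hom_def)

lemma is_pmod_act_zero:
  assumes "is_pmod K M" "x \<le> y"
  shows "act M x y \<zero>\<^bsub>obj M x\<^esub> = \<zero>\<^bsub>obj M y\<^esub>"
proof -
  interpret linear_map K "obj M x" "obj M y" "act M x y"
    using assms by (intro linear_mapI is_pmodD)
  show ?thesis by simp
qed

lemma zero_closed_obj: "is_pmod K M \<Longrightarrow> \<zero>\<^bsub>obj M x\<^esub> \<in> carrier (obj M x)"
  using is_pmodD(1)[of K M x]
  by (meson vectorspace_def module_def abelian_group_def abelian_monoid.zero_closed)

section \<open>Families of vectors\<close>

lemma family_space_simps:
  "carrier (family_space M X) = (\<Pi>\<^sub>E x\<in>X. carrier (obj M x))"
  "\<zero>\<^bsub>family_space M X\<^esub> = (\<lambda>x\<in>X. \<zero>\<^bsub>obj M x\<^esub>)"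
  "s \<oplus>\<^bsub>family_space M X\<^esub> t = (\<lambda>x\<in>X. s x \<oplus>\<^bsub>obj M x\<^esub> t x)"
  "c \<odot>\<^bsub>family_space M X\<^esub> s = (\<lambda>x\<in>X. c \<odot>\<^bsub>obj M x\<^esub> s x)"
  by (simp_all add: family_space_def)

lemma family_space_vectorspace:
  assumes M: "is_pmod K M"
  shows "vectorspace K (family_space M X)"
proof -
  have vs: "vectorspace K (obj M x)" for x using M by (rule is_pmodD)
  then have md: "module K (obj M x)" for x by (simp add: vectorspace_def)
  then have ag: "abelian_group (obj M x)" for x by (simp add: module_def)
  have am: "abelian_monoid (obj M x)" for x using ag by (simp add: abelian_group_def)
  note [simp] = abelian_monoid.zero_closed[OF am] abelian_monoid.a_closed[OF am]
    module.smult_closed[OF md] abelian_monoid.r_zero[OF am] abelian_group.r_neg[OF ag]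
    abelian_group.a_inv_closed[OF ag] module.smult_one[OF md]
  show ?thesis
  proof (rule vs_criteria)
    show "\<forall>v\<in>carrier (family_space M X). \<exists>neg_v\<in>carrier (family_space M X).
        v \<oplus>\<^bsub>family_space M X\<^esub> neg_v = \<zero>\<^bsub>family_space M X\<^esub>"
    proof
      fix v assume v: "v \<in> carrier (family_space M X)"
      then show "\<exists>neg_v\<in>carrier (family_space M X).
          v \<oplus>\<^bsub>family_space M X\<^esub> neg_v = \<zero>\<^bsub>family_space M X\<^esub>"
        by (intro bexI[of _ "\<lambda>x\<in>X. \<ominus>\<^bsub>obj M x\<^esub> v x"])
          (auto simp: family_space_simps PiE_iff cong: restrict_cong)
    qed
  qed (use M in \<open>auto simp: family_space_simps PiE_iff is_pmod_field extensional_def fun_eq_iff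
        abelian_monoid.a_comm[OF am] abelian_monoid.a_lcomm[OF am] abelian_monoid.a_assoc[OF am] module.smult_l_distr[OF md]
        module.smult_r_distr[OF md] module.smult_assoc1[OF md]\<close>)
qed

text \<open>
  Induction on the index set: adjoining an index adds one direct summand.
\<close>

lemma family_space_fin_dim:
  assumes M: "is_pmod K M" and "finite X"
  shows "vectorspace.fin_dim K (family_space M X)"
  using \<open>finite X\<close>
proof (induction X)
  case empty
  interpret vectorspace K "family_space M {}" by (rule family_space_vectorspace[OF M])
  show ?case
    unfolding fin_dim_def by (rule exI[of _ "{}"]) (simp add: span_empty family_space_simps fun_eq_iff)
next
  case (insert a X)
  let ?D = "direct_sum (obj M a) (family_space M X)"
  let ?f = "\<lambda>(v, s). \<lambda>y\<in>insert a X. if y = a then v else s y"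
  have D: "vectorspace K ?D" "vectorspace.fin_dim K ?D"
    using insert M by (auto intro!: direct_sum_is_vs direct_sum_fin_dim family_space_vectorspace is_pmodD)
  have im: "?f ` carrier ?D = carrier (family_space M (insert a X))"
  proof
    show "?f ` carrier ?D \<subseteq> carrier (family_space M (insert a X))"
      by (auto simp: family_space_simps PiE_iff split: if_splits)
    show "carrier (family_space M (insert a X)) \<subseteq> ?f ` carrier ?D"
    proof
      fix s assume s: "s \<in> carrier (family_space M (insert a X))"
      then have "s = ?f (s a, restrict s X)"
        by (auto simp: family_space_simps PiE_iff extensional_def fun_eq_iff)
      moreover have "(s a, restrict s X) \<in> carrier ?D"
        using s by (auto simp: family_space_simps)
      ultimately show "s \<in> ?f ` carrier ?D" by (rule image_eqI)
    qed
  qed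
  have "linear_map K ?D (family_space M (insert a X)) ?f"
    by (intro linear_mapI D(1) family_space_vectorspace M)
      (use im insert(2) in \<open>auto simp: module_hom_def family_space_simps fun_eq_iff split_beta PiE_iff extensional_def\<close>)
  then show ?case using linear_map.rank_nullity_main(2)[OF _ D(2) im] by blast
qed

lemma family_inj_closed:
  assumes "is_pmod K M" "v \<in> carrier (obj M x)"
  shows "family_inj M X x v \<in> carrier (family_space M X)"
proof -
  have "\<zero>\<^bsub>obj M y\<^esub> \<in> carrier (obj M y)" for y
    using assms(1) by (rule zero_closed_obj)
  then show ?thesis using assms by (auto simp: family_space_simps family_inj_def)
qed

lemma family_inj_linear:
  assumes M: "is_pmod K M"
  shows "linear_map K (obj M x) (family_space M X) (family_inj M X x)"
proof (rule linear_mapI)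
  show "family_inj M X x \<in> module_hom K (obj M x) (family_space M X)"
    unfolding module_hom_def
  proof (intro CollectI conjI allI impI Pi_I)
    fix v w assume "v \<in> carrier (obj M x) \<and> w \<in> carrier (obj M x)"
    have "\<zero>\<^bsub>obj M y\<^esub> \<oplus>\<^bsub>obj M y\<^esub> \<zero>\<^bsub>obj M y\<^esub> = \<zero>\<^bsub>obj M y\<^esub>" for y
    proof -
      interpret vectorspace K "obj M y" using M by (rule is_pmodD)
      show ?thesis by simp
    qed
    then show "family_inj M X x (v \<oplus>\<^bsub>obj M x\<^esub> w)
        = family_inj M X x v \<oplus>\<^bsub>family_space M X\<^esub> family_inj M X x w"
      by (auto simp: family_inj_def family_space_simps fun_eq_iff)
  next
    fix c v assume c: "c \<in> carrier K \<and> v \<in> carrier (obj M x)"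
    have "c \<odot>\<^bsub>obj M y\<^esub> \<zero>\<^bsub>obj M y\<^esub> = \<zero>\<^bsub>obj M y\<^esub>" for y
    proof -
      interpret vectorspace K "obj M y" using M by (rule is_pmodD)
      show ?thesis using c by simp
    qed
    then show "family_inj M X x (c \<odot>\<^bsub>obj M x\<^esub> v) = c \<odot>\<^bsub>family_space M X\<^esub> family_inj M X x v"
      by (auto simp: family_inj_def family_space_simps fun_eq_iff)
  qed (rule family_inj_closed[OF M])
qed (rule is_pmodD(1)[OF M] family_space_vectorspace[OF M])+

section \<open>Limits, colimits and the rank\<close>

lemma lim_space_carrier:
  "carrier (lim_space M X) = {s \<in> carrier (family_space M X).
     \<forall>x\<in>X. \<forall>y\<in>X. x \<le> y \<longrightarrow> act M x y (s x) = s y}"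
  by (simp add: lim_space_def)

lemma lim_space_closed: "s \<in> carrier (lim_space M X) \<Longrightarrow> x \<in> X \<Longrightarrow> s x \<in> carrier (obj M x)"
  by (auto simp: lim_space_carrier family_space_simps PiE_iff)

lemma lim_subspace:
  assumes M: "is_pmod K M"
  shows "subspace K (carrier (lim_space M X)) (family_space M X)"
proof (rule subspaceI)
  interpret vectorspace K "family_space M X" by (rule family_space_vectorspace[OF M])
  have hom: "act M x y (v \<oplus>\<^bsub>obj M x\<^esub> w) = act M x y v \<oplus>\<^bsub>obj M y\<^esub> act M x y w"
    "c \<in> carrier K \<Longrightarrow> act M x y (c \<odot>\<^bsub>obj M x\<^esub> v) = c \<odot>\<^bsub>obj M y\<^esub> act M x y v"
    if "x \<le> y" "v \<in> carrier (obj M x)" "w \<in> carrier (obj M x)" for x y v w c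
    using is_pmodD(3)[OF M that(1)] that by (auto simp: module_hom_def)
  show "carrier (lim_space M X) \<subseteq> carrier (family_space M X)" by (auto simp: lim_space_carrier)
  show "\<zero>\<^bsub>family_space M X\<^esub> \<in> carrier (lim_space M X)"
    using M.zero_closed by (auto simp: lim_space_carrier family_space_simps is_pmod_act_zero[OF M])
  fix s t assume st: "s \<in> carrier (lim_space M X)" "t \<in> carrier (lim_space M X)"
  then have "s \<oplus>\<^bsub>family_space M X\<^esub> t \<in> carrier (family_space M X)"
    by (intro M.a_closed) (auto simp: lim_space_carrier)
  then show "s \<oplus>\<^bsub>family_space M X\<^esub> t \<in> carrier (lim_space M X)"
    using st by (auto simp: lim_space_carrier family_space_simps hom PiE_iff)
next
  interpret vectorspace K "family_space M X" by (rule family_space_vectorspace[OF M])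
  fix c s assume cs: "c \<in> carrier K" "s \<in> carrier (lim_space M X)"
  then have "c \<odot>\<^bsub>family_space M X\<^esub> s \<in> carrier (family_space M X)"
    by (intro smult_closed) (auto simp: lim_space_carrier)
  then show "c \<odot>\<^bsub>family_space M X\<^esub> s \<in> carrier (lim_space M X)"
    using cs is_pmodD(3)[OF M] by (auto simp: lim_space_carrier family_space_simps PiE_iff module_hom_def)
qed (rule family_space_vectorspace[OF M])

definition colim_generators :: "('p::order, 'k, 'v) pmod \<Rightarrow> 'p set \<Rightarrow> ('p \<Rightarrow> 'v) set" where
  "colim_generators M X =
     {family_inj M X x v \<ominus>\<^bsub>family_space M X\<^esub> family_inj M X y (act M x y v) | x y v.
        x \<in> X \<and> y \<in> X \<and> x \<le> y \<and> v \<in> carrier (obj M x)}"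

lemma colim_relations_eq_span:
  "colim_relations K M X = module.span K (family_space M X) (colim_generators M X)"
  by (simp add: colim_relations_def colim_generators_def)

lemma colim_generators_closed:
  assumes M: "is_pmod K M"
  shows "colim_generators M X \<subseteq> carrier (family_space M X)"
proof -
  interpret vectorspace K "family_space M X" by (rule family_space_vectorspace[OF M])
  show ?thesis
    unfolding colim_generators_def
    by (auto intro!: M.minus_closed family_inj_closed[OF M] is_pmod_act_closed[OF M])
qed

lemma colim_relations_subspace:
  assumes M: "is_pmod K M"
  shows "subspace K (colim_relations K M X) (family_space M X)"
proof -
  interpret vectorspace K "family_space M X" by (rule family_space_vectorspace[OF M])
  show ?thesis
    unfolding colim_relations_eq_span by (rule span_is_subspace[OF colim_generators_closed[OF M]])
qed

lemma colim_relation: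
  assumes M: "is_pmod K M" and "x \<in> X" "y \<in> X" "x \<le> y" "v \<in> carrier (obj M x)"
  shows "family_inj M X x v \<ominus>\<^bsub>family_space M X\<^esub> family_inj M X y (act M x y v) \<in> colim_relations K M X"
proof -
  interpret vectorspace K "family_space M X" by (rule family_space_vectorspace[OF M])
  show ?thesis
    unfolding colim_relations_eq_span
    by (rule subsetD[OF in_own_span[OF colim_generators_closed[OF M]]])
      (use assms in \<open>auto simp: colim_generators_def\<close>)
qed

text \<open>
  The kernel of the map from the limit to the colimit, evaluated at the same arbitrarily chosen point
  as in the definition of that map.
\<close>

definition lim_colim_ker :: "'k ring \<Rightarrow> ('p::order, 'k, 'v) pmod \<Rightarrow> 'p set \<Rightarrow> ('p \<Rightarrow> 'v) set" where
  "lim_colim_ker K M X = {s \<in> carrier (lim_space M X).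
     family_inj M X (SOME x. x \<in> X) (s (SOME x. x \<in> X)) \<in> colim_relations K M X}"

lemma quotient_space_simps:
  "carrier (quotient_space V W) = a_rcosets\<^bsub>V\<^esub> W"
  "\<zero>\<^bsub>quotient_space V W\<^esub> = W"
  "C \<oplus>\<^bsub>quotient_space V W\<^esub> D = set_add V C D"
  "c \<odot>\<^bsub>quotient_space V W\<^esub> C = (\<Union>v\<in>C. W +>\<^bsub>V\<^esub> (c \<odot>\<^bsub>V\<^esub> v))"
  by (simp_all add: quotient_space_def)

lemma subspace_abelian_subgroup:
  assumes W: "subspace K W V"
  shows "abelian_subgroup W V"
proof -
  interpret vectorspace K V using W by (simp add: subspace_def)
  interpret W: submodule K W V using W by (simp add: subspace_def)
  have "\<ominus>\<^bsub>V\<^esub> w \<in> W" if w: "w \<in> W" for w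
  proof -
    have "(\<ominus>\<^bsub>K\<^esub> \<one>\<^bsub>K\<^esub>) \<odot>\<^bsub>V\<^esub> w \<in> W" using w by (intro W.smult_closed) auto
    then show ?thesis using smult_minus_1[OF subsetD[OF W.subset w]] by metis
  qed
  then have "additive_subgroup W V"
    using W.subset W.zero_closed
    by (intro additive_subgroup.intro M.add.subgroupI) (blast | simp flip: a_inv_def)+
  then show ?thesis using abelian_subgroupI3 M.abelian_group_axioms by blast
qed

text \<open>
  These are the conditions for the projection onto the quotient to be linear with kernel \<open>W\<close>; with
  \<open>surjective_hom_vectorspace\<close> they yield the vector space axioms for its images.
\<close>

lemma quotient_map_hom:
  assumes W: "subspace K W V" and v: "v \<in> carrier V"
  shows "w \<in> carrier V \<Longrightarrow> W +>\<^bsub>V\<^esub> (v \<oplus>\<^bsub>V\<^esub> w) = (W +>\<^bsub>V\<^esub> v) \<oplus>\<^bsub>quotient_space V W\<^esub> (W +>\<^bsub>V\<^esub> w)"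
    and "c \<in> carrier K \<Longrightarrow> W +>\<^bsub>V\<^esub> (c \<odot>\<^bsub>V\<^esub> v) = c \<odot>\<^bsub>quotient_space V W\<^esub> (W +>\<^bsub>V\<^esub> v)"
    and "W +>\<^bsub>V\<^esub> v = \<zero>\<^bsub>quotient_space V W\<^esub> \<longleftrightarrow> v \<in> W"
proof -
  interpret vectorspace K V using W by (simp add: subspace_def)
  interpret W: submodule K W V using W by (simp add: subspace_def)
  interpret A: abelian_subgroup W V by (rule subspace_abelian_subgroup[OF W])
  show "W +>\<^bsub>V\<^esub> (v \<oplus>\<^bsub>V\<^esub> w) = (W +>\<^bsub>V\<^esub> v) \<oplus>\<^bsub>quotient_space V W\<^esub> (W +>\<^bsub>V\<^esub> w)"
    if "w \<in> carrier V" using that v by (simp add: quotient_space_simps A.a_rcos_sum)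
  show "W +>\<^bsub>V\<^esub> v = \<zero>\<^bsub>quotient_space V W\<^esub> \<longleftrightarrow> v \<in> W"
    using v A.a_rcos_self A.a_rcos_const by (auto simp: quotient_space_simps)
  show "W +>\<^bsub>V\<^esub> (c \<odot>\<^bsub>V\<^esub> v) = c \<odot>\<^bsub>quotient_space V W\<^esub> (W +>\<^bsub>V\<^esub> v)" if c: "c \<in> carrier K"
  proof -
    have "W +>\<^bsub>V\<^esub> (c \<odot>\<^bsub>V\<^esub> u) = W +>\<^bsub>V\<^esub> (c \<odot>\<^bsub>V\<^esub> v)" if u: "u \<in> W +>\<^bsub>V\<^esub> v" for u
    proof -
      obtain w where w: "w \<in> W" "u = w \<oplus>\<^bsub>V\<^esub> v" using u by (auto simp: a_r_coset_def')
      have "c \<odot>\<^bsub>V\<^esub> u = c \<odot>\<^bsub>V\<^esub> w \<oplus>\<^bsub>V\<^esub> c \<odot>\<^bsub>V\<^esub> v"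
        using w v c W.subset by (auto simp: smult_r_distr)
      then have "c \<odot>\<^bsub>V\<^esub> u \<in> W +>\<^bsub>V\<^esub> (c \<odot>\<^bsub>V\<^esub> v)" using w c by (auto simp: a_r_coset_def')
      then show ?thesis using c v by (intro M.a_repr_independence[symmetric]) (auto simp: A.a_subgroup)
    qed
    moreover have "v \<in> W +>\<^bsub>V\<^esub> v" using v by (rule A.a_rcos_self)
    ultimately show ?thesis
      unfolding quotient_space_simps by (intro UN_constant_eq[symmetric]) blast+
  qed
qed

lemma lim_colim_ker_subspace:
  assumes M: "is_pmod K M" and X: "X \<noteq> {}"
  shows "subspace K (lim_colim_ker K M X) (family_space M X)"
proof -
  define x where "x = (SOME x. x \<in> X)"
  have x: "x \<in> X" using X by (simp add: x_def some_in_eq)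
  interpret F: vectorspace K "family_space M X" by (rule family_space_vectorspace[OF M])
  interpret I: linear_map K "obj M x" "family_space M X" "family_inj M X x" by (rule family_inj_linear[OF M])
  interpret L: submodule K "carrier (lim_space M X)" "family_space M X"
    using lim_subspace[OF M] by (simp add: subspace_def)
  interpret R: submodule K "colim_relations K M X" "family_space M X"
    using colim_relations_subspace[OF M] by (simp add: subspace_def)
  have c: "s x \<in> carrier (obj M x)" if "s \<in> carrier (lim_space M X)" for s
    using that x by (auto simp: lim_space_carrier family_space_simps)
  have e: "(s \<oplus>\<^bsub>family_space M X\<^esub> t) x = s x \<oplus>\<^bsub>obj M x\<^esub> t x" "(c \<odot>\<^bsub>family_space M X\<^esub> s) x = c \<odot>\<^bsub>obj M x\<^esub> s x"
    "\<zero>\<^bsub>family_space M X\<^esub> x = \<zero>\<^bsub>obj M x\<^esub>" for s t c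
    using x by (auto simp: family_space_simps)
  show ?thesis
    unfolding lim_colim_ker_def x_def[symmetric]
    by (rule subspaceI) (use L.subset in \<open>auto simp: family_space_vectorspace[OF M] e c\<close>)
qed

text \<open>
  Rank-nullity for the map from the limit to its image in the colimit.
\<close>

lemma rk_eq_dims:
  assumes M: "is_pmod K M" and X: "X \<noteq> {}" "finite X"
  shows "rk K M X + vectorspace.dim K ((family_space M X)\<lparr>carrier := lim_colim_ker K M X\<rparr>)
    = vectorspace.dim K ((family_space M X)\<lparr>carrier := carrier (lim_space M X)\<rparr>)"
proof -
  define x where "x = (SOME x. x \<in> X)"
  have x: "x \<in> X" using X by (simp add: x_def some_in_eq)
  let ?L = "(family_space M X)\<lparr>carrier := carrier (lim_space M X)\<rparr>"
  let ?T = "lim_to_colim K M X"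
  let ?R = "colim_relations K M X"
  let ?W = "(colim_space K M X)\<lparr>carrier := ?T ` carrier (lim_space M X)\<rparr>"
  have T: "?T s = ?R +>\<^bsub>family_space M X\<^esub> family_inj M X x (s x)" for s
    by (simp add: lim_to_colim_def colim_inj_def Let_def x_def)
  note q = quotient_map_hom[OF colim_relations_subspace[OF M]]
  interpret I: linear_map K "obj M x" "family_space M X" "family_inj M X x" by (rule family_inj_linear[OF M])
  have L: "vectorspace K ?L" "vectorspace.fin_dim K ?L"
    using subspace_fin_dim[OF lim_subspace[OF M] family_space_fin_dim[OF M X(2)]] by auto
  have c: "s x \<in> carrier (obj M x)" if "s \<in> carrier (lim_space M X)" for s
    using that x by (auto simp: lim_space_carrier family_space_simps)
  have e: "(s \<oplus>\<^bsub>family_space M X\<^esub> t) x = s x \<oplus>\<^bsub>obj M x\<^esub> t x" "(c \<odot>\<^bsub>family_space M X\<^esub> s) x = c \<odot>\<^bsub>obj M x\<^esub> s x"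
    "\<zero>\<^bsub>family_space M X\<^esub> x = \<zero>\<^bsub>obj M x\<^esub>" for s t c
    using x by (auto simp: family_space_simps)
  have z: "?T s = \<zero>\<^bsub>?W\<^esub> \<longleftrightarrow> family_inj M X x (s x) \<in> ?R" if "s \<in> carrier (lim_space M X)" for s
    using q(3) c[OF that] by (simp add: T colim_space_def)
  have T0: "?T \<zero>\<^bsub>?L\<^esub> = \<zero>\<^bsub>?W\<^esub>"
    using lim_subspace[OF M, of X] z[of "\<zero>\<^bsub>?L\<^esub>"] colim_relations_subspace[OF M, of X]
    by (simp add: e subspace_def submodule_def)
  have lin: "linear_map K ?L ?W ?T"
    by (rule surjective_hom_vectorspace(2)[where f = ?T, OF L(1) _ T0])
      (auto simp: T e c colim_space_def q)
  interpret T: linear_map K ?L ?W ?T by (rule lin)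
  have "T.ker = lim_colim_ker K M X"
    unfolding T.ker_def lim_colim_ker_def x_def[symmetric] using z by auto
  moreover have "T.im = ?T ` carrier (lim_space M X)" by (simp add: T.im_def)
  ultimately show ?thesis
    using T.rank_nullity[OF L(2)] by (simp add: rk_def map_rank_def)
qed

section \<open>Natural maps between restrictions\<close>

text \<open>
  Naturality is only asked for on \<open>X\<close>, because the rank over \<open>X\<close> depends on the restriction to \<open>X\<close>
  alone: modules that are not isomorphic will be compared on the sets on which they agree.
\<close>

definition nat_on ::
  "'k ring \<Rightarrow> 'p set \<Rightarrow> ('p::order, 'k, 'v) pmod \<Rightarrow> ('p, 'k, 'w) pmod \<Rightarrow> ('p \<Rightarrow> 'v \<Rightarrow> 'w) \<Rightarrow> bool" where
  "nat_on K X M N \<eta> \<longleftrightarrow>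
     (\<forall>x\<in>X. \<eta> x \<in> module_hom K (obj M x) (obj N x)) \<and>
     (\<forall>x\<in>X. \<forall>y\<in>X. x \<le> y \<longrightarrow> (\<forall>v\<in>carrier (obj M x). \<eta> y (act M x y v) = act N x y (\<eta> x v)))"

definition iso_on ::
  "'k ring \<Rightarrow> 'p set \<Rightarrow> ('p::order, 'k, 'v) pmod \<Rightarrow> ('p, 'k, 'w) pmod \<Rightarrow> bool" where
  "iso_on K X M N \<longleftrightarrow>
     (\<exists>\<eta>. nat_on K X M N \<eta> \<and> (\<forall>x\<in>X. bij_betw (\<eta> x) (carrier (obj M x)) (carrier (obj N x))))"

definition family_map :: "'p set \<Rightarrow> ('p \<Rightarrow> 'v \<Rightarrow> 'w) \<Rightarrow> ('p \<Rightarrow> 'v) \<Rightarrow> 'p \<Rightarrow> 'w" where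
  "family_map X \<eta> s = (\<lambda>x\<in>X. \<eta> x (s x))"

lemma nat_onD:
  assumes "nat_on K X M N \<eta>" "x \<in> X"
  shows "\<eta> x \<in> module_hom K (obj M x) (obj N x)"
    and "v \<in> carrier (obj M x) \<Longrightarrow> \<eta> x v \<in> carrier (obj N x)"
    and "v \<in> carrier (obj M x) \<Longrightarrow> w \<in> carrier (obj M x) \<Longrightarrow>
      \<eta> x (v \<oplus>\<^bsub>obj M x\<^esub> w) = \<eta> x v \<oplus>\<^bsub>obj N x\<^esub> \<eta> x w"
    and "c \<in> carrier K \<Longrightarrow> v \<in> carrier (obj M x) \<Longrightarrow> \<eta> x (c \<odot>\<^bsub>obj M x\<^esub> v) = c \<odot>\<^bsub>obj N x\<^esub> \<eta> x v"
    and "y \<in> X \<Longrightarrow> x \<le> y \<Longrightarrow> v \<in> carrier (obj M x) \<Longrightarrow> \<eta> y (act M x y v) = act N x y (\<eta> x v)"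
proof -
  show h: "\<eta> x \<in> module_hom K (obj M x) (obj N x)" using assms by (simp add: nat_on_def)
  show "v \<in> carrier (obj M x) \<Longrightarrow> \<eta> x v \<in> carrier (obj N x)"
    using module_hom_closed[OF h] by blast
  show "v \<in> carrier (obj M x) \<Longrightarrow> w \<in> carrier (obj M x) \<Longrightarrow>
      \<eta> x (v \<oplus>\<^bsub>obj M x\<^esub> w) = \<eta> x v \<oplus>\<^bsub>obj N x\<^esub> \<eta> x w"
    by (rule module_hom_add[OF h])
  show "c \<in> carrier K \<Longrightarrow> v \<in> carrier (obj M x) \<Longrightarrow> \<eta> x (c \<odot>\<^bsub>obj M x\<^esub> v) = c \<odot>\<^bsub>obj N x\<^esub> \<eta> x v"
    by (rule module_hom_smult[OF h])
  show "y \<in> X \<Longrightarrow> x \<le> y \<Longrightarrow> v \<in> carrier (obj M x) \<Longrightarrow> \<eta> y (act M x y v) = act N x y (\<eta> x v)"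
    by (rule assms(1)[unfolded nat_on_def, THEN conjunct2, rule_format, OF assms(2)])
qed

lemma nat_on_subset:
  assumes "nat_on K X M N \<eta>" "Y \<subseteq> X"
  shows "nat_on K Y M N \<eta>"
  unfolding nat_on_def
  by (intro conjI ballI impI) (simp_all add: nat_onD(1,5)[OF assms(1)] subsetD[OF assms(2)])

lemma iso_on_subset:
  assumes "iso_on K X M N" "Y \<subseteq> X"
  shows "iso_on K Y M N"
proof -
  obtain \<eta> where "nat_on K X M N \<eta>" "\<forall>x\<in>X. bij_betw (\<eta> x) (carrier (obj M x)) (carrier (obj N x))"
    using assms(1) by (auto simp: iso_on_def)
  then show ?thesis
    unfolding iso_on_def using assms(2) by (intro exI[of _ \<eta>]) (auto intro: nat_on_subset)
qed

lemma nat_on_linear: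
  assumes "is_pmod K M" "is_pmod K N" "nat_on K X M N \<eta>" "x \<in> X"
  shows "linear_map K (obj M x) (obj N x) (\<eta> x)"
  using assms by (intro linear_mapI is_pmodD) (auto simp: nat_on_def)

lemma iso_on_refl: "iso_on K X M M"
  unfolding iso_on_def nat_on_def by (intro exI[of _ "\<lambda>x v. v"]) (auto simp: module_hom_def bij_betw_def)

lemma iso_on_trans:
  assumes L: "iso_on K X L M" and M: "iso_on K X M N"
  shows "iso_on K X L N"
proof -
  obtain \<eta> where \<eta>: "nat_on K X L M \<eta>" "\<forall>x\<in>X. bij_betw (\<eta> x) (carrier (obj L x)) (carrier (obj M x))"
    using L by (auto simp: iso_on_def)
  obtain \<theta> where \<theta>: "nat_on K X M N \<theta>" "\<forall>x\<in>X. bij_betw (\<theta> x) (carrier (obj M x)) (carrier (obj N x))"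
    using M by (auto simp: iso_on_def)
  have "nat_on K X L N (\<lambda>x. \<theta> x \<circ> \<eta> x)"
    unfolding nat_on_def
  proof (intro conjI ballI impI)
    fix x assume x: "x \<in> X"
    show "\<theta> x \<circ> \<eta> x \<in> module_hom K (obj L x) (obj N x)"
      unfolding module_hom_def using nat_onD(2-4)[OF \<eta>(1) x] nat_onD(2-4)[OF \<theta>(1) x] by simp
    fix y v assume "y \<in> X" "x \<le> y" "v \<in> carrier (obj L x)"
    then show "(\<theta> y \<circ> \<eta> y) (act L x y v) = act N x y ((\<theta> x \<circ> \<eta> x) v)"
      using nat_onD(2,5)[OF \<eta>(1) x] nat_onD(5)[OF \<theta>(1) x] by simp
  qed
  then show ?thesis
    unfolding iso_on_def using \<eta>(2) \<theta>(2)
    by (intro exI[of _ "\<lambda>x. \<theta> x \<circ> \<eta> x"]) (auto intro: bij_betw_trans)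
qed

lemma family_map_linear:
  assumes M: "is_pmod K M" and N: "is_pmod K N" and \<eta>: "nat_on K X M N \<eta>"
  shows "linear_map K (family_space M X) (family_space N X) (family_map X \<eta>)"
  by (intro linear_mapI family_space_vectorspace M N)
    (auto simp: module_hom_def nat_onD(2-4)[OF \<eta>] family_space_simps family_map_def fun_eq_iff PiE_iff)

lemma family_map_lim:
  assumes \<eta>: "nat_on K X M N \<eta>" and s: "s \<in> carrier (lim_space M X)"
  shows "family_map X \<eta> s \<in> carrier (lim_space N X)"
proof -
  have 1: "act N x y (\<eta> x (s x)) = \<eta> y (s y)" if "x \<in> X" "y \<in> X" "x \<le> y" for x y
    using s that nat_onD(5)[OF \<eta>, of x y "s x"] by (auto simp: lim_space_carrier family_space_simps PiE_iff)
  show ?thesis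
    using s nat_onD(2)[OF \<eta>]
    by (auto simp: lim_space_carrier family_space_simps family_map_def 1)
qed

lemma family_map_inj:
  assumes "is_pmod K M" "is_pmod K N" and "nat_on K X M N \<eta>"
  shows "family_map X \<eta> (family_inj M X x v) = family_inj N X x (\<eta> x v)"
proof -
  have "\<eta> y \<zero>\<^bsub>obj M y\<^esub> = \<zero>\<^bsub>obj N y\<^esub>" if "y \<in> X" for y
  proof -
    interpret linear_map K "obj M y" "obj N y" "\<eta> y" using assms that by (rule nat_on_linear)
    show ?thesis by simp
  qed
  then show ?thesis by (auto simp: family_map_def family_inj_def fun_eq_iff)
qed

text \<open>
  By naturality each generating relation of \<open>M\<close> goes to a generating relation of \<open>N\<close>.
\<close>

lemma family_map_colim_relations:
  assumes M: "is_pmod K M" and N: "is_pmod K N" and \<eta>: "nat_on K X M N \<eta>"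
  shows "family_map X \<eta> ` colim_relations K M X \<subseteq> colim_relations K N X"
proof -
  interpret F: linear_map K "family_space M X" "family_space N X" "family_map X \<eta>"
    using M N \<eta> by (rule family_map_linear)
  have "family_map X \<eta> ` colim_generators M X \<subseteq> colim_relations K N X"
  proof
    fix t assume "t \<in> family_map X \<eta> ` colim_generators M X"
    then obtain x y v where t: "x \<in> X" "y \<in> X" "x \<le> y" "v \<in> carrier (obj M x)"
      "t = family_map X \<eta> (family_inj M X x v \<ominus>\<^bsub>family_space M X\<^esub> family_inj M X y (act M x y v))"
      by (auto simp: colim_generators_def)
    then have "t = family_inj N X x (\<eta> x v) \<ominus>\<^bsub>family_space N X\<^esub> family_inj N X y (act N x y (\<eta> x v))"
      using \<eta> by (simp add: F.f_minus family_inj_closed[OF M] is_pmod_act_closed[OF M]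
          family_map_inj[OF M N \<eta>] nat_onD(5)[OF \<eta>])
    then show "t \<in> colim_relations K N X"
      using t nat_onD(2)[OF \<eta>] by (simp add: colim_relation[OF N])
  qed
  then show ?thesis
    unfolding colim_relations_eq_span[of K M]
    using colim_relations_subspace[OF N, of X] family_map_linear[OF M N \<eta>] colim_generators_closed[OF M]
    by (intro hom_image_span_subset) (auto simp: subspace_def)
qed

lemma family_map_lim_colim_ker:
  assumes M: "is_pmod K M" and N: "is_pmod K N" and \<eta>: "nat_on K X M N \<eta>"
    and X: "X \<noteq> {}" and s: "s \<in> lim_colim_ker K M X"
  shows "family_map X \<eta> s \<in> lim_colim_ker K N X"
proof -
  have x: "(SOME x. x \<in> X) \<in> X" using X by (simp add: some_in_eq)
  have "family_map X \<eta> (family_inj M X (SOME x. x \<in> X) (s (SOME x. x \<in> X))) \<in> colim_relations K N X"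
    using s family_map_colim_relations[OF M N \<eta>] by (auto simp: lim_colim_ker_def)
  then show ?thesis
    using s family_map_lim[OF \<eta>] x
    by (auto simp: lim_colim_ker_def family_map_inj[OF M N \<eta>]) (auto simp: family_map_def)
qed

lemma iso_on_inverse:
  assumes M: "is_pmod K M" and N: "is_pmod K N" and "iso_on K X M N"
  obtains \<eta> \<theta> where "nat_on K X M N \<eta>" "nat_on K X N M \<theta>"
    "\<forall>x\<in>X. \<forall>v\<in>carrier (obj M x). \<theta> x (\<eta> x v) = v"
    "\<forall>x\<in>X. \<forall>v\<in>carrier (obj N x). \<eta> x (\<theta> x v) = v"
    "\<forall>x\<in>X. bij_betw (\<theta> x) (carrier (obj N x)) (carrier (obj M x))"
proof -
  obtain \<eta> where \<eta>: "nat_on K X M N \<eta>"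
    and bij: "\<And>x. x \<in> X \<Longrightarrow> bij_betw (\<eta> x) (carrier (obj M x)) (carrier (obj N x))"
    using assms(3) by (auto simp: iso_on_def)
  define \<theta> where "\<theta> x = inv_into (carrier (obj M x)) (\<eta> x)" for x
  have l: "\<theta> x (\<eta> x v) = v" if "x \<in> X" "v \<in> carrier (obj M x)" for x v
    using bij[OF that(1)] that by (simp add: \<theta>_def bij_betw_def)
  have r: "\<eta> x (\<theta> x v) = v" if "x \<in> X" "v \<in> carrier (obj N x)" for x v
    using bij[OF that(1)] that by (simp add: \<theta>_def bij_betw_def f_inv_into_f)
  have bij': "bij_betw (\<theta> x) (carrier (obj N x)) (carrier (obj M x))" if "x \<in> X" for x
    using bij[OF that] unfolding \<theta>_def by (rule bij_betw_inv_into)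
  then have c: "\<theta> x v \<in> carrier (obj M x)" if "x \<in> X" "v \<in> carrier (obj N x)" for x v
    using that by (auto simp: bij_betw_def)
  have eqI: "v = w" if "x \<in> X" "v \<in> carrier (obj M x)" "w \<in> carrier (obj M x)" "\<eta> x v = \<eta> x w" for x v w
    using that l by metis
  have "nat_on K X N M \<theta>"
    unfolding nat_on_def
  proof (intro conjI ballI impI)
    fix x assume x: "x \<in> X"
    interpret linear_map K "obj M x" "obj N x" "\<eta> x" using M N \<eta> x by (rule nat_on_linear)
    show "\<theta> x \<in> module_hom K (obj N x) (obj M x)"
      unfolding module_hom_def using x c r by (auto intro!: eqI[OF x])
  next
    fix x y v assume *: "x \<in> X" "y \<in> X" "x \<le> y" "v \<in> carrier (obj N x)"
    then have "\<eta> y (act M x y (\<theta> x v)) = act N x y v"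
      using c r by (simp add: nat_onD(5)[OF \<eta>])
    then show "\<theta> y (act N x y v) = act M x y (\<theta> x v)"
      using * l c is_pmod_act_closed[OF M] by metis
  qed
  then show ?thesis using that[of \<eta> \<theta>] \<eta> l r bij' by blast
qed

lemma iso_on_sym:
  "is_pmod K M \<Longrightarrow> is_pmod K N \<Longrightarrow> iso_on K X M N \<Longrightarrow> iso_on K X N M"
  by (metis iso_on_inverse iso_on_def)

text \<open>
  The common core of the invariance of both families of invariants: \<open>F\<close> and \<open>G\<close> stand for the values of
  a functorial subspace of the product at \<open>M\<close> and at \<open>N\<close>.
\<close>

lemma subspace_dim_iso:
  assumes M: "is_pmod K M" and N: "is_pmod K N" and X: "finite X"
    and \<eta>: "nat_on K X M N \<eta>"
    and l: "\<And>x v. x \<in> X \<Longrightarrow> v \<in> carrier (obj M x) \<Longrightarrow> \<theta> x (\<eta> x v) = v"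
    and r: "\<And>x v. x \<in> X \<Longrightarrow> v \<in> carrier (obj N x) \<Longrightarrow> \<eta> x (\<theta> x v) = v"
    and F: "subspace K F (family_space M X)" and G: "subspace K G (family_space N X)"
    and FG: "family_map X \<eta> ` F \<subseteq> G" and GF: "family_map X \<theta> ` G \<subseteq> F"
  shows "vectorspace.dim K ((family_space M X)\<lparr>carrier := F\<rparr>)
    = vectorspace.dim K ((family_space N X)\<lparr>carrier := G\<rparr>)"
proof -
  have Fc: "F \<subseteq> carrier (family_space M X)" and Gc: "G \<subseteq> carrier (family_space N X)"
    using F G by (auto simp: subspace_def submodule_def)
  note Fv = subspace_fin_dim[OF F family_space_fin_dim[OF M X]]
  note Gv = subspace_fin_dim[OF G family_space_fin_dim[OF N X]]
  interpret L: linear_map K "family_space M X" "family_space N X" "family_map X \<eta>"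
    using M N \<eta> by (rule family_map_linear)
  have 1: "family_map X \<theta> (family_map X \<eta> s) = s" if "s \<in> F" for s
    using that Fc l by (auto simp: family_map_def family_space_simps fun_eq_iff PiE_iff extensional_def)
  have 2: "family_map X \<eta> (family_map X \<theta> s) = s" if "s \<in> G" for s
    using that Gc r by (auto simp: family_map_def family_space_simps fun_eq_iff PiE_iff extensional_def)
  have "bij_betw (family_map X \<eta>) F G"
    using FG GF 1 2 by (intro bij_betw_byWitness[where f' = "family_map X \<theta>"]) auto
  moreover have "linear_map K ((family_space M X)\<lparr>carrier := F\<rparr>) ((family_space N X)\<lparr>carrier := G\<rparr>) (family_map X \<eta>)"
    by (intro linear_mapI Fv Gv) (use FG in \<open>auto simp: module_hom_def subsetD[OF Fc]\<close>)
  ultimately show ?thesis using linear_bij_dim(2)[OF _ _ Fv(2)] by fastforce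
qed

lemma rk_iso:
  assumes M: "is_pmod K M" and N: "is_pmod K N" and iso: "iso_on K X M N" and X: "finite X" "X \<noteq> {}"
  shows "rk K M X = rk K N X"
proof -
  obtain \<eta> \<theta> where n: "nat_on K X M N \<eta>" "nat_on K X N M \<theta>"
    and inv: "\<forall>x\<in>X. \<forall>v\<in>carrier (obj M x). \<theta> x (\<eta> x v) = v"
      "\<forall>x\<in>X. \<forall>v\<in>carrier (obj N x). \<eta> x (\<theta> x v) = v"
    using M N iso by (rule iso_on_inverse)
  note d = subspace_dim_iso[OF M N X(1) n(1) inv[rule_format]]
  have "vectorspace.dim K ((family_space M X)\<lparr>carrier := carrier (lim_space M X)\<rparr>)
    = vectorspace.dim K ((family_space N X)\<lparr>carrier := carrier (lim_space N X)\<rparr>)"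
    by (rule d) (use M N n in \<open>auto intro: lim_subspace family_map_lim\<close>)
  moreover have "vectorspace.dim K ((family_space M X)\<lparr>carrier := lim_colim_ker K M X\<rparr>)
    = vectorspace.dim K ((family_space N X)\<lparr>carrier := lim_colim_ker K N X\<rparr>)"
    by (rule d) (use M N n X in \<open>auto intro: lim_colim_ker_subspace family_map_lim_colim_ker\<close>)
  ultimately show ?thesis
    using rk_eq_dims[OF M X(2,1)] rk_eq_dims[OF N X(2,1)] by linarith
qed

section \<open>Direct sums\<close>

lemma pmod_sum_simps [simp]:
  "obj (pmod_sum M N) x = direct_sum (obj M x) (obj N x)"
  "act (pmod_sum M N) x y v = (act M x y (fst v), act N x y (snd v))"
  by (simp_all add: pmod_sum_def map_prod_def split_beta)

lemma pmod_sum_is_pmod: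
  fixes M :: "('p::order, 'k, 'v) pmod"
  assumes M: "is_pmod K M" and N: "is_pmod K N"
  shows "is_pmod K (pmod_sum M N)"
  unfolding is_pmod_def
proof (intro conjI allI impI ballI)
  fix x show "vectorspace K (obj (pmod_sum M N) x)"
    by (simp add: direct_sum_is_vs is_pmodD(1)[OF M] is_pmodD(1)[OF N])
  show "vectorspace.fin_dim K (obj (pmod_sum M N) x)"
    by (simp add: direct_sum_fin_dim is_pmodD(1,2)[OF M] is_pmodD(1,2)[OF N])
next
  fix x y :: 'p assume "x \<le> y"
  then show "act (pmod_sum M N) x y \<in> module_hom K (obj (pmod_sum M N) x) (obj (pmod_sum M N) y)"
    using is_pmodD(3)[OF M, of x y] is_pmodD(3)[OF N, of x y] by (auto simp: module_hom_def)
next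
  fix x y z :: 'p and v assume "x \<le> y \<and> y \<le> z" "v \<in> carrier (obj (pmod_sum M N) x)"
  then show "act (pmod_sum M N) x z v = act (pmod_sum M N) y z (act (pmod_sum M N) x y v)"
    using is_pmodD(5)[OF M, of x y z "fst v"] is_pmodD(5)[OF N, of x y z "snd v"] by auto
qed (auto simp: is_pmodD(4)[OF M] is_pmodD(4)[OF N])

lemma zero_add_obj:
  "is_pmod K M \<Longrightarrow> v \<in> carrier (obj M x) \<Longrightarrow> \<zero>\<^bsub>obj M x\<^esub> \<oplus>\<^bsub>obj M x\<^esub> v = v"
  "is_pmod K M \<Longrightarrow> v \<in> carrier (obj M x) \<Longrightarrow> v \<oplus>\<^bsub>obj M x\<^esub> \<zero>\<^bsub>obj M x\<^esub> = v"
  "is_pmod K M \<Longrightarrow> c \<in> carrier K \<Longrightarrow> c \<odot>\<^bsub>obj M x\<^esub> \<zero>\<^bsub>obj M x\<^esub> = \<zero>\<^bsub>obj M x\<^esub>"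
proof -
  assume M: "is_pmod K M"
  interpret vectorspace K "obj M x" using M by (rule is_pmodD)
  show "v \<in> carrier (obj M x) \<Longrightarrow> \<zero>\<^bsub>obj M x\<^esub> \<oplus>\<^bsub>obj M x\<^esub> v = v"
    "v \<in> carrier (obj M x) \<Longrightarrow> v \<oplus>\<^bsub>obj M x\<^esub> \<zero>\<^bsub>obj M x\<^esub> = v"
    "c \<in> carrier K \<Longrightarrow> c \<odot>\<^bsub>obj M x\<^esub> \<zero>\<^bsub>obj M x\<^esub> = \<zero>\<^bsub>obj M x\<^esub>" by auto
qed

lemma pmod_sum_nat_on:
  assumes M: "is_pmod K M" and N: "is_pmod K N"
  shows "nat_on K X (pmod_sum M N) M (\<lambda>_. fst)"
    and "nat_on K X (pmod_sum M N) N (\<lambda>_. snd)"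
    and "nat_on K X M (pmod_sum M N) (\<lambda>x v. (v, \<zero>\<^bsub>obj N x\<^esub>))"
    and "nat_on K X N (pmod_sum M N) (\<lambda>x v. (\<zero>\<^bsub>obj M x\<^esub>, v))"
  using M N
  by (auto simp: nat_on_def module_hom_def zero_closed_obj zero_add_obj is_pmod_act_zero)

text \<open>
  The common core of additivity. A subspace of the product for the direct sum that is compatible with
  both projections and both inclusions contains, with the two components of a family, their sum,
  hence it is the direct sum of its components.
\<close>

lemma subspace_dim_sum:
  assumes M: "is_pmod K M" and N: "is_pmod K N" and X: "finite X"
    and F: "subspace K F (family_space M X)" and G: "subspace K G (family_space N X)"
    and H: "subspace K H (family_space (pmod_sum M N) X)"
    and HF: "family_map X (\<lambda>_. fst) ` H \<subseteq> F" and HG: "family_map X (\<lambda>_. snd) ` H \<subseteq> G"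
    and FH: "family_map X (\<lambda>x v. (v, \<zero>\<^bsub>obj N x\<^esub>)) ` F \<subseteq> H"
    and GH: "family_map X (\<lambda>x v. (\<zero>\<^bsub>obj M x\<^esub>, v)) ` G \<subseteq> H"
  shows "vectorspace.dim K ((family_space (pmod_sum M N) X)\<lparr>carrier := H\<rparr>)
    = vectorspace.dim K ((family_space M X)\<lparr>carrier := F\<rparr>) + vectorspace.dim K ((family_space N X)\<lparr>carrier := G\<rparr>)"
proof -
  let ?F = "(family_space M X)\<lparr>carrier := F\<rparr>" and ?G = "(family_space N X)\<lparr>carrier := G\<rparr>"
    and ?H = "(family_space (pmod_sum M N) X)\<lparr>carrier := H\<rparr>"
  have Fc: "F \<subseteq> carrier (family_space M X)" and Gc: "G \<subseteq> carrier (family_space N X)"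
    and Hc: "H \<subseteq> carrier (family_space (pmod_sum M N) X)"
    using F G H by (auto simp: subspace_def submodule_def)
  note Fv = subspace_fin_dim[OF F family_space_fin_dim[OF M X]]
  note Gv = subspace_fin_dim[OF G family_space_fin_dim[OF N X]]
  note Hv = subspace_fin_dim[OF H family_space_fin_dim[OF pmod_sum_is_pmod[OF M N] X]]
  interpret H: submodule K H "family_space (pmod_sum M N) X" using H by (simp add: subspace_def)
  let ?f = "\<lambda>s. (family_map X (\<lambda>_. fst) s, family_map X (\<lambda>_. snd) s)"
  let ?g = "\<lambda>(s, t). (\<lambda>x\<in>X. (s x, t x))"
  have g: "?g (s, t) \<in> H" if st: "s \<in> F" "t \<in> G" for s t
  proof -
    have "family_map X (\<lambda>x v. (v, \<zero>\<^bsub>obj N x\<^esub>)) s \<oplus>\<^bsub>family_space (pmod_sum M N) X\<^esub>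
        family_map X (\<lambda>x v. (\<zero>\<^bsub>obj M x\<^esub>, v)) t \<in> H"
      using st FH GH by (intro H.m_closed) auto
    also have "family_map X (\<lambda>x v. (v, \<zero>\<^bsub>obj N x\<^esub>)) s \<oplus>\<^bsub>family_space (pmod_sum M N) X\<^esub>
        family_map X (\<lambda>x v. (\<zero>\<^bsub>obj M x\<^esub>, v)) t = ?g (s, t)"
      using st Fc Gc
      by (auto simp: family_map_def family_space_simps fun_eq_iff PiE_iff subset_iff zero_add_obj[OF M] zero_add_obj[OF N])
    finally show ?thesis .
  qed
  have "bij_betw ?f (carrier ?H) (carrier (direct_sum ?F ?G))"
  proof (rule bij_betw_byWitness[where f' = ?g])
    show "\<forall>s\<in>carrier ?H. ?g (?f s) = s"
      using Hc by (auto simp: family_map_def fun_eq_iff family_space_simps PiE_iff extensional_def)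
    show "\<forall>p\<in>carrier (direct_sum ?F ?G). ?f (?g p) = p"
      using Fc Gc by (auto simp: family_map_def fun_eq_iff family_space_simps PiE_iff extensional_def)
    show "?g ` carrier (direct_sum ?F ?G) \<subseteq> carrier ?H" using g by auto
    show "?f ` carrier ?H \<subseteq> carrier (direct_sum ?F ?G)" using HF HG by auto
  qed
  moreover have "linear_map K ?H (direct_sum ?F ?G) ?f"
    by (intro linear_mapI Hv direct_sum_is_vs Fv Gv)
      (use HF HG in \<open>auto simp: module_hom_def family_map_def family_space_simps fun_eq_iff\<close>)
  ultimately have "vectorspace.dim K (direct_sum ?F ?G) = vectorspace.dim K ?H"
    using linear_bij_dim(2)[OF _ _ Hv(2)] by blast
  then show ?thesis using direct_sum_fin_dim(2)[OF Fv Gv] by simp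
qed

lemma rk_sum:
  assumes M: "is_pmod K M" and N: "is_pmod K N" and X: "finite X" "X \<noteq> {}"
  shows "rk K (pmod_sum M N) X = rk K M X + rk K N X"
proof -
  note S = pmod_sum_is_pmod[OF M N]
  note d = subspace_dim_sum[OF M N X(1)] and n = pmod_sum_nat_on[OF M N, of X]
  have "vectorspace.dim K ((family_space (pmod_sum M N) X)\<lparr>carrier := carrier (lim_space (pmod_sum M N) X)\<rparr>)
    = vectorspace.dim K ((family_space M X)\<lparr>carrier := carrier (lim_space M X)\<rparr>)
      + vectorspace.dim K ((family_space N X)\<lparr>carrier := carrier (lim_space N X)\<rparr>)"
    by (rule d) (use M N S n[THEN family_map_lim] in \<open>auto intro: lim_subspace\<close>)
  moreover have "vectorspace.dim K ((family_space (pmod_sum M N) X)\<lparr>carrier := lim_colim_ker K (pmod_sum M N) X\<rparr>)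
    = vectorspace.dim K ((family_space M X)\<lparr>carrier := lim_colim_ker K M X\<rparr>)
      + vectorspace.dim K ((family_space N X)\<lparr>carrier := lim_colim_ker K N X\<rparr>)"
    by (rule d)
      (use M N S X family_map_lim_colim_ker[OF S M n(1)] family_map_lim_colim_ker[OF S N n(2)]
        family_map_lim_colim_ker[OF M S n(3)] family_map_lim_colim_ker[OF N S n(4)]
        in \<open>auto intro: lim_colim_ker_subspace\<close>)
  ultimately show ?thesis
    using rk_eq_dims[OF M X(2,1)] rk_eq_dims[OF N X(2,1)] rk_eq_dims[OF S X(2,1)] by linarith
qed

section \<open>Spread modules and homomorphisms out of them\<close>

definition order_convex :: "'p::order set \<Rightarrow> bool" where
  "order_convex S \<longleftrightarrow> (\<forall>x\<in>S. \<forall>z\<in>S. \<forall>y. x \<le> y \<and> y \<le> z \<longrightarrow> y \<in> S)"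

lemma order_convexD: "order_convex S \<Longrightarrow> x \<in> S \<Longrightarrow> z \<in> S \<Longrightarrow> x \<le> y \<Longrightarrow> y \<le> z \<Longrightarrow> y \<in> S"
  unfolding order_convex_def by blast

lemma is_spread_convex: "is_spread S \<Longrightarrow> order_convex S"
  unfolding is_spread_def spread_def order_convex_def by clarify (meson order_trans)

lemma spread_module_simps [simp]:
  "carrier (obj (spread_module K S) x) = (if x \<in> S then carrier K else {\<zero>\<^bsub>K\<^esub>})"
  "\<zero>\<^bsub>obj (spread_module K S) x\<^esub> = \<zero>\<^bsub>K\<^esub>"
  "v \<oplus>\<^bsub>obj (spread_module K S) x\<^esub> w = v \<oplus>\<^bsub>K\<^esub> w"
  "c \<odot>\<^bsub>obj (spread_module K S) x\<^esub> v = c \<otimes>\<^bsub>K\<^esub> v"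
  "act (spread_module K S) x y v = (if x \<in> S \<and> y \<in> S then v else \<zero>\<^bsub>K\<^esub>)"
  by (simp_all add: spread_module_def)

lemma spread_module_vectorspace:
  assumes K: "field K"
  shows "vectorspace K (obj (spread_module K S) x)"
proof -
  interpret field K by (rule K)
  have inv: "\<exists>w\<in>carrier K. v \<oplus>\<^bsub>K\<^esub> w = \<zero>\<^bsub>K\<^esub>" if "v \<in> carrier K" for v
    using that by (intro bexI[of _ "\<ominus>\<^bsub>K\<^esub> v"]) (auto simp: r_neg)
  show ?thesis
    by (rule vs_criteria[OF K]) (auto simp: inv a_ac m_ac r_distr l_distr)
qed

lemma spread_module_is_pmod:
  fixes S :: "'p::order set"
  assumes K: "field K" and S: "order_convex S"
  shows "is_pmod K (spread_module K S)"
  unfolding is_pmod_def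
proof (intro conjI allI impI ballI)
  interpret K: field K by (rule K)
  fix x
  show vs: "vectorspace K (obj (spread_module K S) x)" by (rule spread_module_vectorspace[OF K])
  interpret vectorspace K "obj (spread_module K S) x" by (rule vs)
  show "fin_dim"
  proof (cases "x \<in> S")
    case True
    then have 1: "{\<one>\<^bsub>K\<^esub>} \<subseteq> carrier (obj (spread_module K S) x)" by simp
    have "v \<in> span {\<one>\<^bsub>K\<^esub>}" if "v \<in> carrier K" for v
    proof -
      have "v \<odot>\<^bsub>obj (spread_module K S) x\<^esub> \<one>\<^bsub>K\<^esub> \<in> span {\<one>\<^bsub>K\<^esub>}"
        using that in_own_span[OF 1] by (intro submodule.smult_closed[OF span_is_submodule[OF 1]]) auto
      then show ?thesis using that by simp
    qed
    then have "span {\<one>\<^bsub>K\<^esub>} = carrier (obj (spread_module K S) x)"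
      using span_is_subset2[OF 1] True by auto
    then show ?thesis unfolding fin_dim_def using 1 by (intro exI[of _ "{\<one>\<^bsub>K\<^esub>}"]) auto
  next
    case False
    then show ?thesis unfolding fin_dim_def by (intro exI[of _ "{}"]) (auto simp: span_empty)
  qed
next
  interpret K: field K by (rule K)
  fix x y :: 'p assume "x \<le> y"
  show "act (spread_module K S) x y \<in> module_hom K (obj (spread_module K S) x) (obj (spread_module K S) y)"
    by (auto simp: module_hom_def)
next
  fix x y z :: 'p and v assume "x \<le> y \<and> y \<le> z" "v \<in> carrier (obj (spread_module K S) x)"
  then show "act (spread_module K S) x z v = act (spread_module K S) y z (act (spread_module K S) x y v)"
    using order_convexD[OF S, of x z y] by auto
qed auto

text \<open>
  Images of the unit sections under homomorphisms out of the spread module of \<open>S\<close>: they are compatible on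
  \<open>S\<close>, and outside of \<open>S\<close> they die because the spread module does.
\<close>

definition hom_sections :: "('p::order, 'k, 'v) pmod \<Rightarrow> 'p set \<Rightarrow> ('p \<Rightarrow> 'v) set" where
  "hom_sections M S = {s \<in> carrier (lim_space M S).
     \<forall>x\<in>S. \<forall>y. y \<notin> S \<and> x \<le> y \<longrightarrow> act M x y (s x) = \<zero>\<^bsub>obj M y\<^esub>}"

lemma hom_sectionsD:
  assumes "s \<in> hom_sections M S" "x \<in> S"
  shows "s x \<in> carrier (obj M x)"
    and "y \<in> S \<Longrightarrow> x \<le> y \<Longrightarrow> act M x y (s x) = s y"
    and "y \<notin> S \<Longrightarrow> x \<le> y \<Longrightarrow> act M x y (s x) = \<zero>\<^bsub>obj M y\<^esub>"
  using assms by (auto simp: hom_sections_def lim_space_carrier family_space_simps PiE_iff)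

lemma hom_sections_subspace:
  assumes M: "is_pmod K M"
  shows "subspace K (hom_sections M S) (family_space M S)"
proof (rule subspaceI)
  interpret L: submodule K "carrier (lim_space M S)" "family_space M S"
    using lim_subspace[OF M] by (simp add: subspace_def)
  show "hom_sections M S \<subseteq> carrier (family_space M S)" using L.subset by (auto simp: hom_sections_def)
  show "\<zero>\<^bsub>family_space M S\<^esub> \<in> hom_sections M S"
    using L.zero_closed by (auto simp: hom_sections_def family_space_simps is_pmod_act_zero[OF M])
  fix s t assume st: "s \<in> hom_sections M S" "t \<in> hom_sections M S"
  have "act M x y (s x \<oplus>\<^bsub>obj M x\<^esub> t x) = \<zero>\<^bsub>obj M y\<^esub>" if "x \<in> S" "y \<notin> S" "x \<le> y" for x y
    using module_hom_add[OF is_pmodD(3)[OF M that(3)]] hom_sectionsD[OF st(1) that(1)] hom_sectionsD[OF st(2) that(1)] that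
    by (simp add: zero_add_obj[OF M] zero_closed_obj[OF M])
  moreover have "s \<oplus>\<^bsub>family_space M S\<^esub> t \<in> carrier (lim_space M S)"
    using st by (intro L.m_closed) (auto simp: hom_sections_def)
  ultimately show "s \<oplus>\<^bsub>family_space M S\<^esub> t \<in> hom_sections M S"
    by (simp add: hom_sections_def family_space_simps)
next
  interpret L: submodule K "carrier (lim_space M S)" "family_space M S"
    using lim_subspace[OF M] by (simp add: subspace_def)
  fix c s assume s: "c \<in> carrier K" "s \<in> hom_sections M S"
  have "act M x y (c \<odot>\<^bsub>obj M x\<^esub> s x) = \<zero>\<^bsub>obj M y\<^esub>" if "x \<in> S" "y \<notin> S" "x \<le> y" for x y
    using module_hom_smult[OF is_pmodD(3)[OF M that(3)]] hom_sectionsD[OF s(2) that(1)] s that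
    by (simp add: zero_add_obj[OF M])
  moreover have "c \<odot>\<^bsub>family_space M S\<^esub> s \<in> carrier (lim_space M S)"
    using s by (intro L.smult_closed) (auto simp: hom_sections_def)
  ultimately show "c \<odot>\<^bsub>family_space M S\<^esub> s \<in> hom_sections M S"
    by (simp add: hom_sections_def family_space_simps)
qed (rule family_space_vectorspace[OF M])

lemma family_map_hom_sections:
  assumes M: "is_pmod K M" and N: "is_pmod K N" and \<eta>: "nat_on K UNIV M N \<eta>" and s: "s \<in> hom_sections M S"
  shows "family_map S \<eta> s \<in> hom_sections N S"
proof -
  have "act N x y (\<eta> x (s x)) = \<zero>\<^bsub>obj N y\<^esub>" if "x \<in> S" "y \<notin> S" "x \<le> y" for x y
  proof -
    interpret linear_map K "obj M y" "obj N y" "\<eta> y" using M N \<eta> by (rule nat_on_linear) simp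
    show ?thesis
      using nat_onD(5)[OF \<eta>, of x y "s x"] hom_sectionsD[OF s that(1)] that by simp
  qed
  moreover have "family_map S \<eta> s \<in> carrier (lim_space N S)"
    using s by (intro family_map_lim[OF nat_on_subset[OF \<eta> subset_UNIV]]) (simp add: hom_sections_def)
  ultimately show ?thesis by (simp add: hom_sections_def family_map_def)
qed

lemma nat_trans_nat_on: "\<eta> \<in> nat_trans K M N \<Longrightarrow> nat_on K UNIV M N \<eta>"
  by (simp add: nat_trans_def nat_on_def)

definition section_hom ::
  "'k ring \<Rightarrow> ('p::order, 'k, 'v) pmod \<Rightarrow> 'p set \<Rightarrow> ('p \<Rightarrow> 'v) \<Rightarrow> 'p \<Rightarrow> 'k \<Rightarrow> 'v" where
  "section_hom K M S s x = (\<lambda>c\<in>carrier (obj (spread_module K S) x).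
     if x \<in> S then c \<odot>\<^bsub>obj M x\<^esub> s x else \<zero>\<^bsub>obj M x\<^esub>)"

text \<open>
  Naturality at \<open>x \<le> y\<close> is compatibility of the section if \<open>y \<in> S\<close>, and its vanishing at \<open>y\<close> otherwise;
  if \<open>x \<notin> S\<close>, the spread module is zero at \<open>x\<close>.
\<close>

lemma section_hom_nat_trans:
  assumes M: "is_pmod K M" and s: "s \<in> hom_sections M S"
  shows "section_hom K M S s \<in> nat_trans K (spread_module K S) M"
  unfolding nat_trans_def
proof (intro CollectI conjI allI impI ballI IntI)
  interpret K: field K using M by (rule is_pmod_field)
  fix x
  note sx = hom_sectionsD[OF s, of x]
  interpret vectorspace K "obj M x" by (rule is_pmodD(1)[OF M])
  show "section_hom K M S s x \<in> extensional (carrier (obj (spread_module K S) x))"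
    by (simp add: section_hom_def)
  show "section_hom K M S s x \<in> module_hom K (obj (spread_module K S) x) (obj M x)"
    using sx(1) by (auto simp: module_hom_def section_hom_def smult_l_distr smult_assoc1)
  fix y v assume xy: "x \<le> y" and v: "v \<in> carrier (obj (spread_module K S) x)"
  note act0 = is_pmod_act_zero[OF M xy] and acts = module_hom_smult[OF is_pmodD(3)[OF M xy]]
  have y0: "\<zero>\<^bsub>K\<^esub> \<odot>\<^bsub>obj M y\<^esub> s y = \<zero>\<^bsub>obj M y\<^esub>" if "y \<in> S"
  proof -
    interpret Y: vectorspace K "obj M y" by (rule is_pmodD(1)[OF M])
    show ?thesis using hom_sectionsD(1)[OF s that] by simp
  qed
  show "section_hom K M S s y (act (spread_module K S) x y v) = act M x y (section_hom K M S s x v)"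
    using v sx xy act0 acts y0 by (auto simp: section_hom_def zero_add_obj[OF M])
qed

lemma section_hom_bij:
  assumes M: "is_pmod K M" and S: "order_convex S"
  shows "bij_betw (section_hom K M S) (hom_sections M S) (nat_trans K (spread_module K S) M)"
proof (rule bij_betw_byWitness[where f' = "\<lambda>\<eta>. \<lambda>x\<in>S. \<eta> x \<one>\<^bsub>K\<^esub>"])
  interpret K: field K using M by (rule is_pmod_field)
  show "\<forall>s\<in>hom_sections M S. (\<lambda>x\<in>S. section_hom K M S s x \<one>\<^bsub>K\<^esub>) = s"
  proof
    fix s assume s: "s \<in> hom_sections M S"
    have "\<one>\<^bsub>K\<^esub> \<odot>\<^bsub>obj M x\<^esub> s x = s x" if "x \<in> S" for x
      using hom_sectionsD(1)[OF s that] is_pmodD(1)[OF M, of x] by (simp add: vectorspace_def module.smult_one)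
    moreover have "s \<in> extensional S" using s by (simp add: hom_sections_def lim_space_carrier family_space_simps PiE_iff)
    ultimately show "(\<lambda>x\<in>S. section_hom K M S s x \<one>\<^bsub>K\<^esub>) = s"
      by (auto simp: section_hom_def fun_eq_iff extensional_def)
  qed
  have hom: "linear_map K (obj (spread_module K S) x) (obj M x) (\<eta> x)"
    if "\<eta> \<in> nat_trans K (spread_module K S) M" for \<eta> x
    using that by (intro linear_mapI is_pmodD(1) M spread_module_is_pmod S) (auto simp: nat_trans_def K.field_axioms)
  show "\<forall>\<eta>\<in>nat_trans K (spread_module K S) M. section_hom K M S (\<lambda>x\<in>S. \<eta> x \<one>\<^bsub>K\<^esub>) = \<eta>"
  proof (intro ballI ext)
    fix \<eta> x v assume \<eta>: "\<eta> \<in> nat_trans K (spread_module K S) M"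
    interpret H: linear_map K "obj (spread_module K S) x" "obj M x" "\<eta> x" using \<eta> by (rule hom)
    have "\<eta> x \<in> extensional (carrier (obj (spread_module K S) x))" using \<eta> by (simp add: nat_trans_def)
    then show "section_hom K M S (\<lambda>x\<in>S. \<eta> x \<one>\<^bsub>K\<^esub>) x v = \<eta> x v"
      using H.T_smult[of v "\<one>\<^bsub>K\<^esub>"] H.T0_is_0 by (auto simp: section_hom_def extensional_def)
  qed
  show "section_hom K M S ` hom_sections M S \<subseteq> nat_trans K (spread_module K S) M"
    using section_hom_nat_trans[OF M] by auto
  show "(\<lambda>\<eta>. \<lambda>x\<in>S. \<eta> x \<one>\<^bsub>K\<^esub>) ` nat_trans K (spread_module K S) M \<subseteq> hom_sections M S"
  proof (intro image_subsetI)
    fix \<eta> assume \<eta>: "\<eta> \<in> nat_trans K (spread_module K S) M"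
    have nat: "act M x y (\<eta> x \<one>\<^bsub>K\<^esub>) = \<eta> y (if y \<in> S then \<one>\<^bsub>K\<^esub> else \<zero>\<^bsub>K\<^esub>)" if "x \<in> S" "x \<le> y" for x y
    proof -
      have "\<eta> y (act (spread_module K S) x y \<one>\<^bsub>K\<^esub>) = act M x y (\<eta> x \<one>\<^bsub>K\<^esub>)"
        using that by (intro nat_onD(5)[OF nat_trans_nat_on[OF \<eta>]]) auto
      then show ?thesis using that by simp
    qed
    have z: "\<eta> y \<zero>\<^bsub>K\<^esub> = \<zero>\<^bsub>obj M y\<^esub>" for y
    proof -
      interpret H: linear_map K "obj (spread_module K S) y" "obj M y" "\<eta> y" using \<eta> by (rule hom)
      show ?thesis using H.T0_is_0 by simp
    qed
    have c: "\<eta> x \<one>\<^bsub>K\<^esub> \<in> carrier (obj M x)" if "x \<in> S" for x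
    proof -
      interpret H: linear_map K "obj (spread_module K S) x" "obj M x" "\<eta> x" using \<eta> by (rule hom)
      show ?thesis using that by (intro H.T_im) simp
    qed
    show "(\<lambda>x\<in>S. \<eta> x \<one>\<^bsub>K\<^esub>) \<in> hom_sections M S"
      by (simp add: hom_sections_def lim_space_carrier family_space_simps c nat z)
  qed
qed

lemma dim_Hom_spread_module:
  fixes S :: "'p::{finite, order} set"
  assumes M: "is_pmod K M" and S: "order_convex S"
  shows "dim_Hom K (spread_module K S) M = vectorspace.dim K ((family_space M S)\<lparr>carrier := hom_sections M S\<rparr>)"
proof -
  let ?G = "(family_space M S)\<lparr>carrier := hom_sections M S\<rparr>" and ?H = "Hom K (spread_module K S) M"
  have G: "vectorspace K ?G" "vectorspace.fin_dim K ?G"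
    using subspace_fin_dim[OF hom_sections_subspace[OF M] family_space_fin_dim[OF M finite]] by auto
  have bij: "bij_betw (section_hom K M S) (carrier ?G) (carrier ?H)"
    using section_hom_bij[OF M S] by (simp add: Hom_def)
  interpret K: field K using M by (rule is_pmod_field)
  have "linear_map K ?G ?H (section_hom K M S)"
  proof (rule surjective_hom_vectorspace(2)[where f = "section_hom K M S", OF G(1)])
    show "section_hom K M S ` carrier ?G = carrier ?H" using bij by (simp add: bij_betw_def)
    show "section_hom K M S \<zero>\<^bsub>?G\<^esub> = \<zero>\<^bsub>?H\<^esub>"
      by (auto simp: section_hom_def Hom_def fun_eq_iff family_space_simps zero_add_obj[OF M])
  next
    fix s t assume st: "s \<in> carrier ?G" "t \<in> carrier ?G"
    have "v \<odot>\<^bsub>obj M x\<^esub> (s x \<oplus>\<^bsub>obj M x\<^esub> t x) = v \<odot>\<^bsub>obj M x\<^esub> s x \<oplus>\<^bsub>obj M x\<^esub> v \<odot>\<^bsub>obj M x\<^esub> t x"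
      if v: "v \<in> carrier K" and x: "x \<in> S" for v x
    proof -
      interpret vectorspace K "obj M x" by (rule is_pmodD(1)[OF M])
      show ?thesis using v x st hom_sectionsD(1)[of _ M S x] by (simp add: smult_r_distr)
    qed
    then show "section_hom K M S (s \<oplus>\<^bsub>?G\<^esub> t) = section_hom K M S s \<oplus>\<^bsub>?H\<^esub> section_hom K M S t"
      by (auto simp: section_hom_def Hom_def fun_eq_iff family_space_simps zero_add_obj[OF M] zero_closed_obj[OF M])
  next
    fix c s assume c: "c \<in> carrier K" and s: "s \<in> carrier ?G"
    have "v \<odot>\<^bsub>obj M x\<^esub> (c \<odot>\<^bsub>obj M x\<^esub> s x) = c \<odot>\<^bsub>obj M x\<^esub> (v \<odot>\<^bsub>obj M x\<^esub> s x)"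
      if v: "v \<in> carrier K" and x: "x \<in> S" for v x
    proof -
      interpret vectorspace K "obj M x" by (rule is_pmodD(1)[OF M])
      have "s x \<in> carrier (obj M x)" using s x hom_sectionsD(1)[of s M S x] by simp
      then show ?thesis using v c by (simp add: K.m_comm flip: smult_assoc1)
    qed
    then show "section_hom K M S (c \<odot>\<^bsub>?G\<^esub> s) = c \<odot>\<^bsub>?H\<^esub> section_hom K M S s"
      using c by (auto simp: section_hom_def Hom_def fun_eq_iff family_space_simps zero_add_obj[OF M])
  qed
  then show ?thesis
    using linear_bij_dim(2)[OF _ bij G(2)] by (simp add: dim_Hom_def)
qed

lemma dim_Hom_spread_module_eq_0_iff:
  fixes S :: "'p::{finite, order} set"
  assumes M: "is_pmod K M" and S: "order_convex S"
  shows "dim_Hom K (spread_module K S) M = 0 \<longleftrightarrow> hom_sections M S = {\<lambda>x\<in>S. \<zero>\<^bsub>obj M x\<^esub>}"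
  unfolding dim_Hom_spread_module[OF M S]
  using dim_eq_0_iff[OF subspace_fin_dim[OF hom_sections_subspace[OF M] family_space_fin_dim[OF M finite]]]
  by (simp add: family_space_simps)

text \<open>
  Over a set with a least point \<open>p\<close>, a section is determined by its value at \<open>p\<close>.
\<close>

lemma dim_Hom_spread_module_eq_0:
  fixes S :: "'p::{finite, order} set"
  assumes M: "is_pmod K M" and S: "order_convex S"
    and least: "p \<in> S" "\<And>x. x \<in> S \<Longrightarrow> p \<le> x"
    and vanish: "\<And>s. s \<in> hom_sections M S \<Longrightarrow> s p = \<zero>\<^bsub>obj M p\<^esub>"
  shows "dim_Hom K (spread_module K S) M = 0"
proof -
  have "s = (\<lambda>x\<in>S. \<zero>\<^bsub>obj M x\<^esub>)" if s: "s \<in> hom_sections M S" for s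
  proof (rule extensionalityI)
    show "s \<in> extensional S" using s by (simp add: hom_sections_def lim_space_carrier family_space_simps PiE_iff)
    fix x assume x: "x \<in> S"
    then have "s x = act M p x (s p)" using hom_sectionsD(2)[OF s least(1) x] least(2) by simp
    then show "s x = (\<lambda>x\<in>S. \<zero>\<^bsub>obj M x\<^esub>) x" using x least vanish[OF s] by (simp add: is_pmod_act_zero[OF M])
  qed simp
  moreover have "(\<lambda>x\<in>S. \<zero>\<^bsub>obj M x\<^esub>) \<in> hom_sections M S"
    using hom_sections_subspace[OF M, of S] by (simp add: subspace_def submodule_def family_space_simps)
  ultimately show ?thesis unfolding dim_Hom_spread_module_eq_0_iff[OF M S] by blast
qed

lemma dim_Hom_iso:
  fixes S :: "'p::{finite, order} set"
  assumes M: "is_pmod K M" and N: "is_pmod K N" and iso: "iso_on K UNIV M N" and S: "order_convex S"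
  shows "dim_Hom K (spread_module K S) M = dim_Hom K (spread_module K S) N"
proof -
  obtain \<eta> \<theta> where n: "nat_on K UNIV M N \<eta>" "nat_on K UNIV N M \<theta>"
    and inv: "\<forall>x\<in>UNIV. \<forall>v\<in>carrier (obj M x). \<theta> x (\<eta> x v) = v"
      "\<forall>x\<in>UNIV. \<forall>v\<in>carrier (obj N x). \<eta> x (\<theta> x v) = v"
    using M N iso by (rule iso_on_inverse)
  show ?thesis
    unfolding dim_Hom_spread_module[OF M S] dim_Hom_spread_module[OF N S]
    by (rule subspace_dim_iso[OF M N _ nat_on_subset[OF n(1)]])
      (use M N inv family_map_hom_sections[OF M N n(1)] family_map_hom_sections[OF N M n(2)]
        in \<open>auto intro: hom_sections_subspace\<close>)
qed

lemma dim_Hom_sum: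
  fixes S :: "'p::{finite, order} set"
  assumes M: "is_pmod K M" and N: "is_pmod K N" and S: "order_convex S"
  shows "dim_Hom K (spread_module K S) (pmod_sum M N)
    = dim_Hom K (spread_module K S) M + dim_Hom K (spread_module K S) N"
proof -
  note P = pmod_sum_is_pmod[OF M N] and n = pmod_sum_nat_on[OF M N, of UNIV]
  show ?thesis
    unfolding dim_Hom_spread_module[OF M S] dim_Hom_spread_module[OF N S] dim_Hom_spread_module[OF P S]
    by (rule subspace_dim_sum[OF M N])
      (use M N P family_map_hom_sections[OF P M n(1)] family_map_hom_sections[OF P N n(2)]
        family_map_hom_sections[OF M P n(3)] family_map_hom_sections[OF N P n(4)]
        in \<open>auto intro: hom_sections_subspace\<close>)
qed

section \<open>Convex sets with a least element are connected spreads\<close>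

lemma convex_is_spread:
  fixes T :: "'p::{finite, order} set"
  assumes T: "order_convex T"
  shows "is_spread T"
proof -
  let ?A = "{a \<in> T. \<forall>b\<in>T. b \<le> a \<longrightarrow> b = a}" and ?B = "{b \<in> T. \<forall>c\<in>T. b \<le> c \<longrightarrow> c = b}"
  have A: "\<exists>a\<in>?A. a \<le> x" if "x \<in> T" for x
    using finite_has_minimal2[OF finite that] by (simp add: Bex_def) (metis)
  have B: "\<exists>b\<in>?B. x \<le> b" if "x \<in> T" for x
    using finite_has_maximal2[OF finite that] by (simp add: Bex_def) (metis)
  have "T = spread ?A ?B"
  proof
    show "T \<subseteq> spread ?A ?B" unfolding spread_def using A B by blast
    show "spread ?A ?B \<subseteq> T" unfolding spread_def using order_convexD[OF T] by blast
  qed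
  moreover have "antichain ?A" "antichain ?B" unfolding antichain_def by auto
  moreover have "\<forall>a\<in>?A. \<exists>b\<in>?B. a \<le> b" using B by blast
  moreover have "\<forall>b\<in>?B. \<exists>a\<in>?A. a \<le> b" using A by blast
  ultimately show ?thesis unfolding is_spread_def by blast
qed

text \<open>
  Every point \<open>x\<close> of \<open>T\<close> other than \<open>p\<close> covers a point \<open>y \<ge> p\<close>, which lies in \<open>T\<close> by convexity; descending
  leads to \<open>p\<close>.
\<close>

lemma least_hasse_connected:
  fixes T :: "'p::{finite, order} set"
  assumes T: "order_convex T" and p: "p \<in> T" "\<And>x. x \<in> T \<Longrightarrow> p \<le> x"
  shows "hasse_connected T"
proof -
  let ?E = "{(u, v). u \<in> T \<and> v \<in> T \<and> (covers u v \<or> covers v u)}"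
  have path: "(p, x) \<in> ?E\<^sup>*" if "x \<in> T" for x
    using that
  proof (induction "card {..x}" arbitrary: x rule: less_induct)
    case less
    show ?case
    proof (cases "x = p")
      case False
      then have "p \<in> {y. p \<le> y \<and> y < x}" using p less.prems by (auto simp: order.strict_iff_order)
      then obtain y where y: "p \<le> y" "y < x" and max: "\<forall>c. p \<le> c \<and> c < x \<and> y \<le> c \<longrightarrow> y = c"
        using finite_has_maximal2[of "{y. p \<le> y \<and> y < x}" p] by auto
      have yT: "y \<in> T" using order_convexD[OF T p(1) less.prems] y by auto
      have "\<not> (y < z \<and> z < x)" for z
        using max[rule_format, of z] order_trans[OF y(1), of z] by (auto simp: less_le)
      then have "covers y x" using y(2) by (simp add: covers_def)
      then have "(y, x) \<in> ?E" using yT less.prems by simp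
      moreover have "{..y} \<subset> {..x}" 
        unfolding psubset_eq using y(2) by (auto dest: order_trans[of _ y x])
      then have "(p, y) \<in> ?E\<^sup>*" using less.hyps[OF _ yT] by (simp add: psubset_card_mono)
      ultimately show ?thesis by (rule rtrancl_into_rtrancl[rotated])
    qed simp
  qed
  have "sym (?E\<^sup>*)" by (intro sym_rtrancl) (auto simp: sym_def)
  then have "(x, p) \<in> ?E\<^sup>*" if "x \<in> T" for x using path[OF that] by (rule symD)
  then show ?thesis unfolding hasse_connected_def using path p(1) by (auto intro: rtrancl_trans)
qed

section \<open>Vanishing of the rank\<close>

text \<open>
  A vector and its image further up represent the same element of the colimit.
\<close>

lemma colim_relations_transport:
  assumes M: "is_pmod K M" and xy: "x \<in> X" "y \<in> X" "x \<le> y" and v: "v \<in> carrier (obj M x)"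
  shows "family_inj M X x v \<in> colim_relations K M X \<longleftrightarrow> family_inj M X y (act M x y v) \<in> colim_relations K M X"
proof -
  let ?V = "family_space M X"
  interpret V: vectorspace K ?V by (rule family_space_vectorspace[OF M])
  interpret A: abelian_subgroup "colim_relations K M X" ?V
    by (rule subspace_abelian_subgroup[OF colim_relations_subspace[OF M]])
  have c: "family_inj M X x v \<in> carrier ?V" "family_inj M X y (act M x y v) \<in> carrier ?V"
    using v xy by (auto intro!: family_inj_closed[OF M] is_pmod_act_closed[OF M])
  have d: "family_inj M X x v \<ominus>\<^bsub>?V\<^esub> family_inj M X y (act M x y v) \<in> colim_relations K M X"
    using M xy v by (rule colim_relation)
  have "family_inj M X x v = (family_inj M X x v \<ominus>\<^bsub>?V\<^esub> family_inj M X y (act M x y v)) \<oplus>\<^bsub>?V\<^esub> family_inj M X y (act M x y v)"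
    using c by (simp add: a_minus_def V.M.a_assoc V.M.l_neg)
  moreover have "family_inj M X y (act M x y v) = \<ominus>\<^bsub>?V\<^esub> (family_inj M X x v \<ominus>\<^bsub>?V\<^esub> family_inj M X y (act M x y v)) \<oplus>\<^bsub>?V\<^esub> family_inj M X x v"
    using c by (simp add: a_minus_def V.M.minus_add V.M.a_assoc V.M.l_neg V.M.a_comm[of "\<ominus>\<^bsub>?V\<^esub> family_inj M X x v"])
  ultimately show ?thesis using d A.a_closed A.a_inv_closed by metis
qed

text \<open>
  The values of a section at the two ends of an edge represent the same element of the colimit, so
  along a path it makes no difference where the composite from the limit to the colimit is computed.
\<close>

lemma lim_colim_vanish_iff:
  assumes M: "is_pmod K M" and X: "hasse_connected X" and s: "s \<in> carrier (lim_space M X)"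
    and xy: "x \<in> X" "y \<in> X"
  shows "family_inj M X x (s x) \<in> colim_relations K M X \<longleftrightarrow> family_inj M X y (s y) \<in> colim_relations K M X"
proof -
  have step: "family_inj M X a (s a) \<in> colim_relations K M X \<longleftrightarrow> family_inj M X b (s b) \<in> colim_relations K M X"
    if "a \<in> X" "b \<in> X" "a < b" for a b
  proof -
    have "s a \<in> carrier (obj M a)" "act M a b (s a) = s b"
      using s that by (auto simp: lim_space_carrier family_space_simps PiE_iff)
    then show ?thesis using colim_relations_transport[OF M, of a X b "s a"] that by simp
  qed
  have "(x, y) \<in> {(u, v). u \<in> X \<and> v \<in> X \<and> (covers u v \<or> covers v u)}\<^sup>*"
    using X xy by (simp add: hasse_connected_def)
  then show ?thesis
    by (induction rule: rtrancl_induct) (auto simp: covers_def dest: step)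
qed

lemma family_inj_zero: "is_pmod K M \<Longrightarrow> family_inj M X x \<zero>\<^bsub>obj M x\<^esub> \<in> colim_relations K M X"
proof -
  assume M: "is_pmod K M"
  interpret linear_map K "obj M x" "family_space M X" "family_inj M X x" by (rule family_inj_linear[OF M])
  interpret R: submodule K "colim_relations K M X" "family_space M X"
    using colim_relations_subspace[OF M] by (simp add: subspace_def)
  show ?thesis by simp
qed

lemma rk_eq_0:
  fixes X :: "'p::{finite, order} set"
  assumes M: "is_pmod K M" and X: "hasse_connected X" and p: "p \<in> X"
    and vanish: "\<And>s. s \<in> carrier (lim_space M X) \<Longrightarrow> family_inj M X p (s p) \<in> colim_relations K M X"
  shows "rk K M X = 0"
proof -
  have ne: "X \<noteq> {}" using p by auto
  have "(SOME x. x \<in> X) \<in> X" using p by (auto intro: someI)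
  then have "lim_colim_ker K M X = carrier (lim_space M X)"
    using vanish lim_colim_vanish_iff[OF M X _ _ p] by (auto simp: lim_colim_ker_def)
  then show ?thesis using rk_eq_dims[OF M ne] by simp
qed

lemma rk_eq_0_at_zero:
  fixes X :: "'p::{finite, order} set"
  assumes M: "is_pmod K M" and X: "hasse_connected X" and p: "p \<in> X" and "carrier (obj M p) = {\<zero>\<^bsub>obj M p\<^esub>}"
  shows "rk K M X = 0"
proof (rule rk_eq_0[OF M X p])
  fix s assume "s \<in> carrier (lim_space M X)"
  then have "s p = \<zero>\<^bsub>obj M p\<^esub>" using p assms(4) by (auto simp: lim_space_carrier family_space_simps PiE_iff)
  then show "family_inj M X p (s p) \<in> colim_relations K M X" by (simp add: family_inj_zero[OF M])
qed

lemma rk_spread_module_eq_0: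
  fixes X :: "'p::{finite, order} set"
  assumes "field K" "order_convex S" "hasse_connected X" "\<not> X \<subseteq> S"
  shows "rk K (spread_module K S) X = 0"
proof -
  obtain p where "p \<in> X" "p \<notin> S" using assms(4) by blast
  then show ?thesis
    using assms by (intro rk_eq_0_at_zero[of K _ _ p] spread_module_is_pmod) auto
qed

lemma iso_on_identity:
  assumes "is_pmod K M" "\<And>x. x \<in> X \<Longrightarrow> obj M x = obj N x"
    "\<And>x y v. x \<in> X \<Longrightarrow> y \<in> X \<Longrightarrow> x \<le> y \<Longrightarrow> v \<in> carrier (obj M x) \<Longrightarrow> act M x y v = act N x y v"
  shows "iso_on K X M N"
  unfolding iso_on_def nat_on_def using assms
  by (intro exI[of _ "\<lambda>x v. v"]) (auto simp: module_hom_def bij_betw_def)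

lemma rk_spread_module_cong:
  fixes X :: "'p::{finite, order} set"
  assumes "field K" "order_convex S" "order_convex T" "X \<noteq> {}" "X \<inter> S = X \<inter> T"
  shows "rk K (spread_module K S) X = rk K (spread_module K T) X"
proof -
  have "x \<in> S \<longleftrightarrow> x \<in> T" if "x \<in> X" for x using assms(5) that by blast
  then have "iso_on K X (spread_module K S) (spread_module K T)"
    using assms by (intro iso_on_identity spread_module_is_pmod) (auto simp: spread_module_def)
  then show ?thesis using assms by (intro rk_iso spread_module_is_pmod) auto
qed

section \<open>Two spread modules glued along their least point\<close>

definition glued_module :: "'k ring \<Rightarrow> 'p::order set \<Rightarrow> 'p set \<Rightarrow> 'p \<Rightarrow> ('p, 'k, 'k \<times> 'k) pmod" where
  "glued_module K A B a =
     (let N = pmod_sum (spread_module K A) (spread_module K B)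
      in N\<lparr>obj := \<lambda>x. (obj N x)\<lparr>carrier := {z \<in> carrier (obj N x). x = a \<longrightarrow> fst z = snd z}\<rparr>\<rparr>)"

lemma glued_module_simps [simp]:
  "carrier (obj (glued_module K A B a) x) =
     {(v, w). v \<in> (if x \<in> A then carrier K else {\<zero>\<^bsub>K\<^esub>}) \<and> w \<in> (if x \<in> B then carrier K else {\<zero>\<^bsub>K\<^esub>}) \<and> (x = a \<longrightarrow> v = w)}"
  "\<zero>\<^bsub>obj (glued_module K A B a) x\<^esub> = (\<zero>\<^bsub>K\<^esub>, \<zero>\<^bsub>K\<^esub>)"
  "z \<oplus>\<^bsub>obj (glued_module K A B a) x\<^esub> z' = (fst z \<oplus>\<^bsub>K\<^esub> fst z', snd z \<oplus>\<^bsub>K\<^esub> snd z')"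
  "c \<odot>\<^bsub>obj (glued_module K A B a) x\<^esub> z = (c \<otimes>\<^bsub>K\<^esub> fst z, c \<otimes>\<^bsub>K\<^esub> snd z)"
  "act (glued_module K A B a) x y z =
     (if x \<in> A \<and> y \<in> A then fst z else \<zero>\<^bsub>K\<^esub>, if x \<in> B \<and> y \<in> B then snd z else \<zero>\<^bsub>K\<^esub>)"
proof -
  let ?N = "pmod_sum (spread_module K A) (spread_module K B)"
  have obj: "obj (glued_module K A B a) x = (obj ?N x)\<lparr>carrier := {z \<in> carrier (obj ?N x). x = a \<longrightarrow> fst z = snd z}\<rparr>"
    by (simp add: glued_module_def Let_def)
  show "carrier (obj (glued_module K A B a) x) =
     {(v, w). v \<in> (if x \<in> A then carrier K else {\<zero>\<^bsub>K\<^esub>}) \<and> w \<in> (if x \<in> B then carrier K else {\<zero>\<^bsub>K\<^esub>}) \<and> (x = a \<longrightarrow> v = w)}"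
    unfolding obj by auto
  show "\<zero>\<^bsub>obj (glued_module K A B a) x\<^esub> = (\<zero>\<^bsub>K\<^esub>, \<zero>\<^bsub>K\<^esub>)"
    "z \<oplus>\<^bsub>obj (glued_module K A B a) x\<^esub> z' = (fst z \<oplus>\<^bsub>K\<^esub> fst z', snd z \<oplus>\<^bsub>K\<^esub> snd z')"
    "c \<odot>\<^bsub>obj (glued_module K A B a) x\<^esub> z = (c \<otimes>\<^bsub>K\<^esub> fst z, c \<otimes>\<^bsub>K\<^esub> snd z)"
    unfolding obj by simp_all
  have "act (glued_module K A B a) = act ?N" by (simp add: glued_module_def Let_def)
  then show "act (glued_module K A B a) x y z =
     (if x \<in> A \<and> y \<in> A then fst z else \<zero>\<^bsub>K\<^esub>, if x \<in> B \<and> y \<in> B then snd z else \<zero>\<^bsub>K\<^esub>)"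
    by simp
qed

lemma glued_module_obj:
  "x \<noteq> a \<Longrightarrow> obj (glued_module K A B a) x = obj (pmod_sum (spread_module K A) (spread_module K B)) x"
  by (simp add: glued_module_def Let_def)

text \<open>
  A map into the space at \<open>a\<close> from a smaller point is zero, since \<open>a\<close> is the least point of \<open>A \<union> B\<close>. Hence
  the structure maps preserve the diagonal condition.
\<close>

lemma glued_module_is_pmod:
  fixes A B :: "'p::order set"
  assumes K: "field K" and A: "order_convex A" and B: "order_convex B"
    and least: "a \<in> A" "a \<in> B" "\<And>x. x \<in> A \<union> B \<Longrightarrow> a \<le> x"
  shows "is_pmod K (glued_module K A B a)"
  unfolding is_pmod_def
proof (intro conjI allI impI ballI)
  interpret K: field K by (rule K)
  let ?N = "pmod_sum (spread_module K A) (spread_module K B)"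
  have N: "is_pmod K ?N" using assms by (intro pmod_sum_is_pmod spread_module_is_pmod)
  fix x
  have obj: "obj (glued_module K A B a) x = (obj ?N x)\<lparr>carrier := {z \<in> carrier (obj ?N x). x = a \<longrightarrow> fst z = snd z}\<rparr>"
    by (simp add: glued_module_def Let_def)
  have "subspace K {z \<in> carrier (obj ?N x). x = a \<longrightarrow> fst z = snd z} (obj ?N x)"
    by (rule subspaceI) (use is_pmodD(1)[OF N] in \<open>auto split: if_splits\<close>)
  note sub = subspace_fin_dim[OF this is_pmodD(2)[OF N]]
  show "vectorspace K (obj (glued_module K A B a) x)" "vectorspace.fin_dim K (obj (glued_module K A B a) x)"
    unfolding obj by (rule sub)+
next
  interpret K: field K by (rule K)
  fix x y :: 'p assume xy: "x \<le> y"
  show "act (glued_module K A B a) x y \<in> module_hom K (obj (glued_module K A B a) x) (obj (glued_module K A B a) y)"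
  proof -
    have "x = a" if "y = a" "x \<in> A \<or> x \<in> B" using that xy least(3)[of x] by auto
    then show ?thesis using least(1,2) by (auto simp: module_hom_def split: if_splits)
  qed
next
  fix x y z :: 'p and v assume "x \<le> y \<and> y \<le> z" "v \<in> carrier (obj (glued_module K A B a) x)"
  then show "act (glued_module K A B a) x z v = act (glued_module K A B a) y z (act (glued_module K A B a) x y v)"
    using order_convexD[OF A, of x z y] order_convexD[OF B, of x z y] by auto
qed auto

lemma glued_module_swap:
  "iso_on K X (glued_module K A B a) (glued_module K B A a)"
  unfolding iso_on_def nat_on_def
  by (intro exI[of _ "\<lambda>x. prod.swap"] conjI ballI bij_betw_byWitness[where f' = prod.swap])
    (auto simp: module_hom_def)

text \<open>
  Over a subset of \<open>A\<close>, the glued module is the direct sum of the diagonal copy of \<open>M\<^bsub>A\<^esub>\<close>, consisting of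
  the vectors \<open>(c, c)\<close> at points of \<open>B\<close> and \<open>(c, 0)\<close> elsewhere, and of the second summand \<open>M\<^bsub>B\<^esub>\<close> cut down
  to \<open>B - {a}\<close>. The latter vanishes at \<open>a \<in> X\<close> and does not contribute to the rank.
\<close>

lemma rk_glued_module_within:
  fixes A B :: "'p::{finite, order} set"
  assumes K: "field K" and A: "order_convex A" and B: "order_convex B"
    and least: "a \<in> A" "a \<in> B" "\<And>x. x \<in> A \<union> B \<Longrightarrow> a \<le> x"
    and X: "hasse_connected X" "a \<in> X" "X \<subseteq> A"
  shows "rk K (glued_module K A B a) X = rk K (spread_module K A) X"
proof -
  interpret K: field K by (rule K)
  let ?M = "spread_module K A" and ?N = "spread_module K (B - {a})" and ?G = "glued_module K A B a"
  have B': "order_convex (B - {a})"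
    unfolding order_convex_def
  proof (intro ballI allI impI)
    fix x z y assume *: "x \<in> B - {a}" "z \<in> B - {a}" "x \<le> y \<and> y \<le> z"
    then have "y \<in> B" using order_convexD[OF B, of x z y] by simp
    moreover have "y \<noteq> a" using * least(3)[of x] by auto
    ultimately show "y \<in> B - {a}" by simp
  qed
  have M: "is_pmod K ?M" and N: "is_pmod K ?N" and G: "is_pmod K ?G"
    using K A B B' least by (auto intro: spread_module_is_pmod glued_module_is_pmod)
  have cancel: "v \<oplus>\<^bsub>K\<^esub> (w \<oplus>\<^bsub>K\<^esub> \<ominus>\<^bsub>K\<^esub> v) = w" if "v \<in> carrier K" "w \<in> carrier K" for v w
    using that K.a_lcomm[of v w "\<ominus>\<^bsub>K\<^esub> v"] by (simp add: K.r_neg)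
  let ?f = "\<lambda>x (v, w). (v, (if x \<in> B then v else \<zero>\<^bsub>K\<^esub>) \<oplus>\<^bsub>K\<^esub> w)"
  let ?g = "\<lambda>x (v, w). (v, w \<ominus>\<^bsub>K\<^esub> (if x \<in> B then v else \<zero>\<^bsub>K\<^esub>))"
  have "nat_on K X (pmod_sum ?M ?N) ?G ?f"
    unfolding nat_on_def
  proof (intro conjI ballI impI)
    fix x assume x: "x \<in> X"
    show "?f x \<in> module_hom K (obj (pmod_sum ?M ?N) x) (obj ?G x)"
      using x X(3) least by (auto simp: module_hom_def K.a_ac K.r_distr split: if_splits)
  next
    fix x y v assume xy: "x \<in> X" "y \<in> X" "x \<le> y" and v: "v \<in> carrier (obj (pmod_sum ?M ?N) x)"
    have xyA: "x \<in> A" "y \<in> A" using xy X(3) by auto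
    have "x = a" if "y = a" using that xy xyA least(3)[of x] by simp
    \<comment> \<open>\<open>B\<close> is closed under going down to points above \<open>a\<close>, so no vector starting in \<open>A - B\<close> gets a diagonal part at \<open>y\<close>.\<close>
    moreover have "x \<in> B" if "y \<in> B"
      using order_convexD[OF B least(2) that, of x] xy xyA least(3)[of x] by simp
    ultimately show "?f y (act (pmod_sum ?M ?N) x y v) = act ?G x y (?f x v)"
      using v xyA least(2) by (cases v; cases "x = a"; cases "y = a"; cases "x \<in> B"; cases "y \<in> B") simp_all
  qed
  moreover have "bij_betw (?f x) (carrier (obj (pmod_sum ?M ?N) x)) (carrier (obj ?G x))" if "x \<in> X" for x
    using that X(3) least
    by (intro bij_betw_byWitness[where f' = "?g x"])
      (auto simp: a_minus_def K.a_ac K.r_neg K.r_neg1 K.r_neg2 K.l_neg cancel split: if_splits)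
  ultimately have "iso_on K X (pmod_sum ?M ?N) ?G" unfolding iso_on_def by blast
  then have "rk K ?G X = rk K (pmod_sum ?M ?N) X"
    using X M N G by (intro rk_iso[symmetric] pmod_sum_is_pmod) auto
  also have "\<dots> = rk K ?M X + rk K ?N X" using X M N by (intro rk_sum) auto
  also have "rk K ?N X = 0" using X by (intro rk_spread_module_eq_0 K B') auto
  finally show ?thesis by simp
qed

section \<open>Modules on a fork\<close>

locale fork =
  fixes K :: "'k ring" and p q u v :: "'p::{finite, order}"
  assumes field: "field K"
    and less: "p < q" "q < u" "q < v"
    and incomparable: "\<not> u \<le> v" "\<not> v \<le> u"
begin

sublocale K: field K by (rule field)

definition A :: "'p set" where "A = {x. p \<le> x \<and> \<not> v \<le> x}"
definition B :: "'p set" where "B = {x. p \<le> x \<and> \<not> u \<le> x}"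
definition C :: "'p set" where "C = A \<inter> B"
definition S :: "'p set" where "S = C - {p}"

lemma convex: "order_convex A" "order_convex B" "order_convex C" "order_convex S"
proof -
  show A: "order_convex A" unfolding order_convex_def A_def by (auto dest: order_trans)
  show B: "order_convex B" unfolding order_convex_def B_def by (auto dest: order_trans)
  show C: "order_convex C" unfolding order_convex_def C_def using order_convexD[OF A] order_convexD[OF B] by blast
  show "order_convex S"
    unfolding order_convex_def
  proof (intro ballI allI impI)
    fix x z y assume *: "x \<in> S" "z \<in> S" "x \<le> y \<and> y \<le> z"
    then have "y \<in> C" using order_convexD[OF C, of x z y] by (simp add: S_def)
    moreover have "p < x" using * by (auto simp: S_def C_def A_def)
    ultimately show "y \<in> S" using * by (auto simp: S_def)
  qed
qed

lemma p_least: "p \<in> A" "p \<in> B" "p \<in> C" "x \<in> A \<union> B \<Longrightarrow> p \<le> x" "x \<in> C \<Longrightarrow> p \<le> x"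
  using less by (auto simp: A_def B_def C_def)

lemma q_mem: "q \<in> A" "q \<in> B" using less by (auto simp: A_def B_def)

lemma u_mem: "u \<in> A" "u \<notin> B" "u \<notin> C" and v_mem: "v \<notin> A" "v \<in> B" "v \<notin> C"
  using less incomparable by (auto simp: A_def B_def C_def)

abbreviation "G \<equiv> glued_module K A B p"

lemma modules:
  "is_pmod K (spread_module K A)" "is_pmod K (spread_module K B)" "is_pmod K (spread_module K C)"
  "is_pmod K (spread_module K S)" "is_pmod K G"
  using field convex p_least by (auto intro!: spread_module_is_pmod glued_module_is_pmod)

text \<open>
  If \<open>X\<close> contains a point above \<open>p\<close> outside of \<open>A\<close> and one outside of \<open>B\<close>, then these lie above \<open>v\<close> and
  \<open>u\<close>, and \<open>q, u, v \<in> X\<close> by convexity. A section has the form \<open>(c, c)\<close> at \<open>p\<close>. In the colimit this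
  equals \<open>(c, c)\<close> at \<open>q\<close>, and there the summands \<open>(c, 0)\<close> and \<open>(0, c)\<close> are vectors of their own, which die
  at \<open>v\<close> and at \<open>u\<close>. The point \<open>q\<close> strictly between is essential: at \<open>p\<close> itself the summands are not in \<open>G\<close>.
\<close>

lemma rk_glued_outside:
  assumes X: "hasse_connected X" "order_convex X" "p \<in> X" "\<not> X \<subseteq> A" "\<not> X \<subseteq> B"
  shows "rk K G X = 0"
proof -
  obtain y z where y: "y \<in> X" "y \<notin> A" and z: "z \<in> X" "z \<notin> B" using X by blast
  show ?thesis
  proof (cases "p \<le> y \<and> p \<le> z")
    case False
    then obtain x where x: "x \<in> X" "\<not> p \<le> x" using y z by blast
    then have "x \<notin> A" "x \<notin> B" "x \<noteq> p" by (auto simp: A_def B_def)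
    then have "carrier (obj G x) = {\<zero>\<^bsub>obj G x\<^esub>}" by auto
    then show ?thesis using modules X x by (intro rk_eq_0_at_zero) auto
  next
    case True
    then have "v \<le> y" "u \<le> z" using y z by (auto simp: A_def B_def)
    then have mem: "q \<in> X" "u \<in> X" "v \<in> X"
      using order_convexD[OF X(2,3) y(1)] order_convexD[OF X(2,3) z(1)] less by auto
    let ?R = "colim_relations K G X"
    interpret R: submodule K ?R "family_space G X"
      using colim_relations_subspace[OF modules(5)] by (simp add: subspace_def)
    interpret I: linear_map K "obj G q" "family_space G X" "family_inj G X q"
      by (rule family_inj_linear[OF modules(5)])
    have "p \<noteq> q" using less by simp
    show ?thesis
    proof (rule rk_eq_0[OF modules(5) X(1,3)])
      fix s assume "s \<in> carrier (lim_space G X)"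
      then have "s p \<in> carrier (obj G p)" using X(3) by (rule lim_space_closed)
      then obtain c where c: "c \<in> carrier K" "s p = (c, c)" using p_least by auto
      have "family_inj G X q (c, \<zero>\<^bsub>K\<^esub>) \<in> ?R"
        using colim_relations_transport[OF modules(5) mem(1,3), of "(c, \<zero>\<^bsub>K\<^esub>)"] family_inj_zero[OF modules(5), of X v]
          c q_mem v_mem less \<open>p \<noteq> q\<close> by simp
      moreover have "family_inj G X q (\<zero>\<^bsub>K\<^esub>, c) \<in> ?R"
        using colim_relations_transport[OF modules(5) mem(1,2), of "(\<zero>\<^bsub>K\<^esub>, c)"] family_inj_zero[OF modules(5), of X u]
          c q_mem u_mem less \<open>p \<noteq> q\<close> by simp
      ultimately have "family_inj G X q (c, \<zero>\<^bsub>K\<^esub>) \<oplus>\<^bsub>family_space G X\<^esub> family_inj G X q (\<zero>\<^bsub>K\<^esub>, c) \<in> ?R"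
        by (rule R.m_closed)
      moreover have "family_inj G X q ((c, \<zero>\<^bsub>K\<^esub>) \<oplus>\<^bsub>obj G q\<^esub> (\<zero>\<^bsub>K\<^esub>, c))
          = family_inj G X q (c, \<zero>\<^bsub>K\<^esub>) \<oplus>\<^bsub>family_space G X\<^esub> family_inj G X q (\<zero>\<^bsub>K\<^esub>, c)"
        using c q_mem \<open>p \<noteq> q\<close> by (intro I.T_add) auto
      ultimately have "family_inj G X q (c, c) \<in> ?R" using c by simp
      then show "family_inj G X p (s p) \<in> ?R"
        using colim_relations_transport[OF modules(5) X(3) mem(1), of "s p"] c p_least q_mem less by simp
    qed
  qed
qed

text \<open>
  If \<open>p \<notin> X\<close>, then \<open>G\<close> balances \<open>A\<close> and \<open>B\<close> together, and \<open>C\<close> balances \<open>S\<close>. If \<open>p \<in> X\<close>, then \<open>S\<close> contributes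
  nothing; over \<open>X \<subseteq> A\<close> one has \<open>X \<inter> C = X \<inter> B\<close>, so that \<open>G\<close> balances \<open>A\<close>, and \<open>C\<close> balances \<open>B\<close>; the case
  \<open>X \<subseteq> B\<close> is symmetric, and otherwise all five ranks are zero.
\<close>

lemma rk_identity:
  assumes X: "hasse_connected X" "order_convex X"
  shows "rk K G X + rk K (spread_module K C) X
    = rk K (spread_module K A) X + rk K (spread_module K B) X + rk K (spread_module K S) X"
proof -
  have ne: "X \<noteq> {}" using X by (simp add: hasse_connected_def)
  note fin = finite[of X]
  show ?thesis
  proof (cases "p \<in> X")
    case False
    have "obj G x = obj (pmod_sum (spread_module K A) (spread_module K B)) x" if "x \<in> X" for x
      using that False by (intro glued_module_obj) auto
    then have "iso_on K X G (pmod_sum (spread_module K A) (spread_module K B))"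
      by (rule iso_on_identity[OF modules(5)]) simp_all
    then have "rk K G X = rk K (spread_module K A) X + rk K (spread_module K B) X"
      using rk_iso[OF modules(5) pmod_sum_is_pmod[OF modules(1,2)] _ fin ne] rk_sum[OF modules(1,2) fin ne]
      by simp
    moreover have "rk K (spread_module K C) X = rk K (spread_module K S) X"
      using False ne convex field by (intro rk_spread_module_cong) (auto simp: S_def)
    ultimately show ?thesis by simp
  next
    case True
    then have S: "rk K (spread_module K S) X = 0"
      using X convex field by (intro rk_spread_module_eq_0) (auto simp: S_def)
    consider "X \<subseteq> A" | "X \<subseteq> B" | "\<not> X \<subseteq> A" "\<not> X \<subseteq> B" by blast
    then show ?thesis
    proof cases
      case 1
      then have "rk K G X = rk K (spread_module K A) X"
        using X(1) True convex p_least field by (intro rk_glued_module_within) auto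
      moreover have "rk K (spread_module K C) X = rk K (spread_module K B) X"
        using 1 ne convex field by (intro rk_spread_module_cong) (auto simp: C_def)
      ultimately show ?thesis using S by simp
    next
      case 2
      have swap: "is_pmod K (glued_module K B A p)"
        using field convex p_least by (intro glued_module_is_pmod) auto
      have "rk K G X = rk K (glued_module K B A p) X"
        using rk_iso[OF modules(5) swap glued_module_swap fin ne] .
      also have "\<dots> = rk K (spread_module K B) X"
        using 2 X(1) True convex p_least field by (intro rk_glued_module_within) auto
      finally have "rk K G X = rk K (spread_module K B) X" .
      moreover have "rk K (spread_module K C) X = rk K (spread_module K A) X"
        using 2 ne convex field by (intro rk_spread_module_cong) (auto simp: C_def)
      ultimately show ?thesis using S by simp
    next
      case 3
      then have "\<not> X \<subseteq> C" by (auto simp: C_def)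
      then show ?thesis
        using 3 S rk_glued_outside[OF X True 3] rk_spread_module_eq_0[OF field _ X(1)] convex by simp
    qed
  qed
qed

text \<open>
  The value \<open>s p\<close> of a section over \<open>C\<close> must die at \<open>u\<close> and at \<open>v\<close>, which lie outside of \<open>C\<close>. But \<open>M\<^bsub>A\<^esub>\<close>
  maps injectively from \<open>p\<close> to \<open>u\<close>, \<open>M\<^bsub>B\<^esub>\<close> from \<open>p\<close> to \<open>v\<close>, and in \<open>G\<close> the vector \<open>(c, c)\<close> goes to
  \<open>(c, 0)\<close> at \<open>u\<close>. The space of \<open>M\<^bsub>S\<^esub>\<close> at \<open>p\<close> is zero. For \<open>M\<^bsub>C\<^esub>\<close> itself, the constant section \<open>1\<close> satisfies
  the conditions.
\<close>

lemma dim_Hom_C: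
  "dim_Hom K (spread_module K C) (spread_module K A) = 0"
  "dim_Hom K (spread_module K C) (spread_module K B) = 0"
  "dim_Hom K (spread_module K C) (spread_module K S) = 0"
  "dim_Hom K (spread_module K C) G = 0"
  "dim_Hom K (spread_module K C) (spread_module K C) \<noteq> 0"
proof -
  have pu: "p \<le> u" "p \<le> v" using less by auto
  note zero = dim_Hom_spread_module_eq_0[OF _ convex(3) p_least(3,5)]
  have *: "s p \<in> carrier (obj M p)" "act M p u (s p) = \<zero>\<^bsub>obj M u\<^esub>" "act M p v (s p) = \<zero>\<^bsub>obj M v\<^esub>"
    if "s \<in> hom_sections M C" for s and M :: "('p, 'k, 'v) pmod"
    using hom_sectionsD[OF that p_least(3)] pu u_mem v_mem by auto
  show "dim_Hom K (spread_module K C) (spread_module K A) = 0"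
    using *[of _ "spread_module K A"] p_least u_mem by (intro zero modules) auto
  show "dim_Hom K (spread_module K C) (spread_module K B) = 0"
    using *[of _ "spread_module K B"] p_least v_mem by (intro zero modules) auto
  show "dim_Hom K (spread_module K C) (spread_module K S) = 0"
    using *[of _ "spread_module K S"] by (intro zero modules) (auto simp: S_def)
  show "dim_Hom K (spread_module K C) G = 0"
  proof (intro zero modules)
    fix s assume s: "s \<in> hom_sections G C"
    obtain c where "s p = (c, c)" using *(1)[OF s] by auto
    then show "s p = \<zero>\<^bsub>obj G p\<^esub>" using *(2)[OF s] p_least u_mem by simp
  qed
  have "(\<lambda>x\<in>C. \<one>\<^bsub>K\<^esub>) \<in> hom_sections (spread_module K C) C"
    by (simp add: hom_sections_def lim_space_carrier family_space_simps)
  moreover have "(\<lambda>x\<in>C. \<one>\<^bsub>K\<^esub>) \<noteq> (\<lambda>x\<in>C. \<zero>\<^bsub>obj (spread_module K C) x\<^esub>)"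
  proof
    assume "(\<lambda>x\<in>C. \<one>\<^bsub>K\<^esub>) = (\<lambda>x\<in>C. \<zero>\<^bsub>obj (spread_module K C) x\<^esub>)"
    from fun_cong[OF this, of p] show False using p_least by simp
  qed
  ultimately show "dim_Hom K (spread_module K C) (spread_module K C) \<noteq> 0"
    unfolding dim_Hom_spread_module_eq_0_iff[OF modules(3) convex(3)] by blast
qed

end

section \<open>Representatives of isomorphism classes\<close>

lemma pmod_iso_iff_iso_on:
  assumes L: "is_pmod K L" and M: "is_pmod K M"
  shows "pmod_iso K L M \<longleftrightarrow> iso_on K UNIV L M"
proof
  assume "pmod_iso K L M"
  then obtain \<eta> where "\<eta> \<in> nat_trans K L M" "\<forall>x. bij_betw (\<eta> x) (carrier (obj L x)) (carrier (obj M x))"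
    by (auto simp: pmod_iso_def)
  then show "iso_on K UNIV L M"
    unfolding iso_on_def by (intro exI[of _ \<eta>]) (simp add: nat_trans_nat_on)
next
  assume "iso_on K UNIV L M"
  then obtain \<eta> where \<eta>: "nat_on K UNIV L M \<eta>" and bij: "\<forall>x. bij_betw (\<eta> x) (carrier (obj L x)) (carrier (obj M x))"
    by (auto simp: iso_on_def)
  let ?\<theta> = "\<lambda>x. restrict (\<eta> x) (carrier (obj L x))"
  have "?\<theta> x \<in> module_hom K (obj L x) (obj M x)" for x
  proof -
    interpret vectorspace K "obj L x" by (rule is_pmodD(1)[OF L])
    show ?thesis using nat_onD(2-4)[OF \<eta>, of x] by (auto simp: module_hom_def)
  qed
  moreover have "?\<theta> y (act L x y v) = act M x y (?\<theta> x v)" if "x \<le> y" "v \<in> carrier (obj L x)" for x y v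
    using that nat_onD(5)[OF \<eta>, of x y v] is_pmod_act_closed[OF L that] by simp
  ultimately have "?\<theta> \<in> nat_trans K L M" by (simp add: nat_trans_def)
  moreover have "bij_betw (?\<theta> x) (carrier (obj L x)) (carrier (obj M x))" for x
    using bij by (simp cong: bij_betw_cong)
  ultimately show "pmod_iso K L M" unfolding pmod_iso_def by (intro bexI[of _ ?\<theta>]) auto
qed

text \<open>
  The modules at hand have vectors in \<open>K\<close>, in \<open>K \<times> K\<close> or in pairs of sequences, whereas \<open>iso_class\<close> collects
  modules with vectors of type \<open>nat \<Rightarrow> 'k\<close>. Moving the structure along an injection of types yields
  representatives without a choice of bases.
\<close>

definition transport_module :: "('v \<Rightarrow> 'w) \<Rightarrow> ('k, 'v) module \<Rightarrow> ('k, 'w) module" where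
  "transport_module h V =
     \<lparr>carrier = h ` carrier V, monoid.mult = undefined, one = undefined, ring.zero = h \<zero>\<^bsub>V\<^esub>,
      add = (\<lambda>v w. h (the_inv h v \<oplus>\<^bsub>V\<^esub> the_inv h w)), smult = (\<lambda>c v. h (c \<odot>\<^bsub>V\<^esub> the_inv h v))\<rparr>"

definition transport :: "('v \<Rightarrow> 'w) \<Rightarrow> ('p, 'k, 'v) pmod \<Rightarrow> ('p, 'k, 'w) pmod" where
  "transport h M = \<lparr>obj = \<lambda>x. transport_module h (obj M x), act = \<lambda>x y v. h (act M x y (the_inv h v))\<rparr>"

lemma transport_is_pmod:
  fixes M :: "('p::order, 'k, 'v) pmod"
  assumes h: "inj h" and M: "is_pmod K M"
  shows "is_pmod K (transport h M)" and "iso_on K X M (transport h M)"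
proof -
  note simps = transport_def transport_module_def the_inv_f_f[OF h]
  have lin: "vectorspace K (obj (transport h M) x)" "linear_map K (obj M x) (obj (transport h M) x) h" for x
    by (rule surjective_hom_vectorspace[where f = h, OF is_pmodD(1)[OF M, of x]]; simp add: simps)+
  have bij: "bij_betw h (carrier (obj M x)) (carrier (obj (transport h M) x))" for x
    using h by (auto simp: simps bij_betw_def intro: inj_on_subset)
  have fd: "vectorspace.fin_dim K (obj (transport h M) x)" for x
    using linear_bij_dim(1)[OF lin(2) bij is_pmodD(2)[OF M]] .
  show "is_pmod K (transport h M)"
    unfolding is_pmod_def
  proof (intro conjI allI impI ballI)
    fix x y :: 'p assume xy: "x \<le> y"
    show "act (transport h M) x y \<in> module_hom K (obj (transport h M) x) (obj (transport h M) y)"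
      using module_hom_add[OF is_pmodD(3)[OF M xy]] module_hom_smult[OF is_pmodD(3)[OF M xy]]
        is_pmod_act_closed[OF M xy]
      by (auto simp: module_hom_def simps)
  next
    fix x v assume "v \<in> carrier (obj (transport h M) x)"
    then show "act (transport h M) x x v = v" using is_pmodD(4)[OF M] by (auto simp: simps)
  next
    fix x y z :: 'p and v assume *: "x \<le> y \<and> y \<le> z" "v \<in> carrier (obj (transport h M) x)"
    then obtain w where "w \<in> carrier (obj M x)" "v = h w" by (auto simp: simps)
    then show "act (transport h M) x z v = act (transport h M) y z (act (transport h M) x y v)"
      using is_pmodD(5)[OF M, of x y z w] * by (simp add: simps)
  qed (rule lin fd)+
  have "nat_on K X M (transport h M) (\<lambda>_. h)"
    using lin(2) by (auto simp: nat_on_def simps linear_map_def mod_hom_def mod_hom_axioms_def)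
  then show "iso_on K X M (transport h M)"
    unfolding iso_on_def using bij by (intro exI[of _ "\<lambda>_. h"]) simp
qed

text \<open>
  In particular, the isomorphism class of \<open>M\<close> is not empty, so that numerical invariants have a
  value on it.
\<close>

lemma umod_representative:
  fixes M :: "('p::order, 'k, 'v) pmod" and h :: "'v \<Rightarrow> nat \<Rightarrow> 'k"
  assumes "inj h" "is_pmod K M"
  obtains L :: "('p, 'k) umod" where "is_pmod K L" "iso_on K UNIV L M"
proof
  note t = transport_is_pmod[OF assms]
  show "is_pmod K (transport h M)" by (rule t)
  show i: "iso_on K UNIV (transport h M) M" by (rule iso_on_sym[OF assms(2) t])
qed

lemma inj_const_seq: "inj (\<lambda>(c::'k) (n::nat). c)"
  by (auto simp: inj_on_def fun_eq_iff)

lemma inj_pair_seq: "inj (\<lambda>(c::'k, d) (n::nat). if n = 0 then c else d)"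
proof (rule injI, clarify)
  fix a b c d :: 'k assume "(\<lambda>n::nat. if n = 0 then a else b) = (\<lambda>n. if n = 0 then c else d)"
  from fun_cong[OF this, of 0] fun_cong[OF this, of 1] show "a = c \<and> b = d" by simp
qed

lemma inj_interleave: "inj (\<lambda>(f::nat \<Rightarrow> 'k, g) n. if even n then f (n div 2) else g (n div 2))"
proof (rule injI, clarify)
  fix f g f' g' :: "nat \<Rightarrow> 'k"
  assume eq: "(\<lambda>n. if even n then f (n div 2) else g (n div 2)) = (\<lambda>n. if even n then f' (n div 2) else g' (n div 2))"
  have "f n = f' n" "g n = g' n" for n
    using fun_cong[OF eq, of "2 * n"] fun_cong[OF eq, of "2 * n + 1"] by simp_all
  then show "f = f' \<and> g = g'" by auto
qed

lemma iso_class_mem: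
  assumes "is_pmod K M"
  shows "L \<in> iso_class K M \<longleftrightarrow> is_pmod K L \<and> iso_on K UNIV L M"
  using assms by (auto simp: iso_class_def pmod_iso_iff_iso_on)

lemma iso_class_cong:
  assumes L: "is_pmod K L" and M: "is_pmod K M" and LM: "iso_on K UNIV L M"
  shows "iso_class K L = iso_class K M"
proof (rule Set.set_eqI)
  fix N
  show "N \<in> iso_class K L \<longleftrightarrow> N \<in> iso_class K M"
    unfolding iso_class_mem[OF L] iso_class_mem[OF M]
    using iso_on_trans[of K UNIV N L M] iso_on_trans[of K UNIV N M L] LM iso_on_sym[OF L M LM] by blast
qed

section \<open>Kernels of additive invariants\<close>

lemma free_extension_add:
  assumes "i \<in> I"
  shows "free_extension I f (a + b) i = free_extension I f a i + free_extension I f b i"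
  using assms unfolding free_extension_def
  by (simp add: setsum_keys_plus_distrib[where f = "\<lambda>c n. n * int (the_elem ((\<lambda>M. f M i) ` c))"] ring_distribs)

lemma free_extension_uminus:
  "i \<in> I \<Longrightarrow> free_extension I f (- a) i = - free_extension I f a i"
  by (simp add: free_extension_def sum_negf)

lemma free_extension_diff:
  "i \<in> I \<Longrightarrow> free_extension I f (a - b) i = free_extension I f a i - free_extension I f b i"
  using free_extension_add[of i I f a "- b"] by (simp add: free_extension_uminus)

lemma free_extension_frag_of:
  "i \<in> I \<Longrightarrow> free_extension I f (frag_of c) i = int (the_elem ((\<lambda>M. f M i) ` c))"
  by (simp add: free_extension_def keys_frag_of)

definition K0_relations :: "'k ring \<Rightarrow> (('p::order, 'k) umod set \<Rightarrow>\<^sub>0 int) set" where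
  "K0_relations K = generate (free_Abelian_group (iso_classes K)) (split_relations K)"

lemma split_relations_closed:
  fixes K :: "'k ring"
  shows "split_relations K \<subseteq> carrier (free_Abelian_group (iso_classes K :: ('p::order, 'k) umod set set))"
proof
  fix r assume "r \<in> (split_relations K :: (('p, 'k) umod set \<Rightarrow>\<^sub>0 int) set)"
  then obtain M N :: "('p, 'k) umod" where MN: "is_pmod K M" "is_pmod K N"
    and r: "r = frag_of (iso_class K (pmod_sum M N)) - (frag_of (iso_class K M) + frag_of (iso_class K N))"
    by (auto simp: split_relations_def)
  note S = pmod_sum_is_pmod[OF MN]
  obtain L :: "('p, 'k) umod" where L: "is_pmod K L" "iso_on K UNIV L (pmod_sum M N)"
    using inj_interleave S by (rule umod_representative)
  have "iso_class K (pmod_sum M N) = iso_class K L" using iso_class_cong[OF L(1) S L(2)] by simp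
  then have "{iso_class K (pmod_sum M N), iso_class K M, iso_class K N} \<subseteq> iso_classes K"
    using MN L unfolding iso_classes_def by auto
  moreover have "Poly_Mapping.keys r \<subseteq> {iso_class K (pmod_sum M N), iso_class K M, iso_class K N}"
    unfolding r using keys_diff keys_add by (fastforce simp: keys_frag_of)
  ultimately show "r \<in> carrier (free_Abelian_group (iso_classes K))" by auto
qed

text \<open>
  What is needed for a family of invariants to induce a well-defined map on the split
  Grothendieck group.
\<close>

locale additive_invariant =
  fixes K :: "'k ring" and I :: "'i set" and f :: "('p::order, 'k) umod \<Rightarrow> 'i \<Rightarrow> nat"
  assumes iso_invariant: "is_pmod K L \<Longrightarrow> is_pmod K M \<Longrightarrow> iso_on K UNIV L M \<Longrightarrow> i \<in> I \<Longrightarrow> f L i = f M i"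
    and additive: "is_pmod K L \<Longrightarrow> is_pmod K M \<Longrightarrow> is_pmod K N \<Longrightarrow> iso_on K UNIV L (pmod_sum M N) \<Longrightarrow> i \<in> I \<Longrightarrow>
      f L i = f M i + f N i"
begin

lemma free_extension_iso_class:
  assumes L: "is_pmod K L" and M: "is_pmod K M" and LM: "iso_on K UNIV L M" and i: "i \<in> I"
  shows "free_extension I f (frag_of (iso_class K M)) i = int (f L i)"
proof -
  have "(\<lambda>N. f N i) ` iso_class K M = {f L i}"
  proof
    show "{f L i} \<subseteq> (\<lambda>N. f N i) ` iso_class K M" using L LM by (auto simp: iso_class_mem[OF M])
    show "(\<lambda>N. f N i) ` iso_class K M \<subseteq> {f L i}"
      unfolding iso_class_cong[OF L M LM, symmetric]
      using iso_invariant[OF _ L _ i] by (auto simp: iso_class_mem[OF L])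
  qed
  then show ?thesis using i by (simp add: free_extension_frag_of)
qed

lemma free_extension_split_relation:
  assumes r: "r \<in> split_relations K" and i: "i \<in> I"
  shows "free_extension I f r i = 0"
proof -
  obtain M N :: "('p, 'k) umod" where MN: "is_pmod K M" "is_pmod K N"
    and r: "r = frag_of (iso_class K (pmod_sum M N)) - (frag_of (iso_class K M) + frag_of (iso_class K N))"
    using r by (auto simp: split_relations_def)
  note S = pmod_sum_is_pmod[OF MN]
  obtain L :: "('p, 'k) umod" where L: "is_pmod K L" "iso_on K UNIV L (pmod_sum M N)"
    using inj_interleave S by (rule umod_representative)
  show ?thesis
    unfolding r free_extension_diff[OF i] free_extension_add[OF i]
      free_extension_iso_class[OF L(1) S L(2) i]
      free_extension_iso_class[OF MN(1) MN(1) iso_on_refl i] free_extension_iso_class[OF MN(2) MN(2) iso_on_refl i]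
    using additive[OF L(1) MN L(2) i] by simp
qed

text \<open>
  So the linear extension is constant on cosets of the relations, and \<open>the_elem\<close> in \<open>K0_hom\<close> picks a genuine
  common value.
\<close>

lemma free_extension_K0_relations:
  assumes "r \<in> K0_relations K" and i: "i \<in> I"
  shows "free_extension I f r i = 0"
  using assms(1) unfolding K0_relations_def
proof (induction rule: generate.induct)
  case one
  then show ?case using i by (simp add: free_extension_def)
next
  case (incl h)
  then show ?case using free_extension_split_relation[OF _ i] by blast
next
  case (inv h)
  then have "h \<in> carrier (free_Abelian_group (iso_classes K))"
    using split_relations_closed by (rule rev_subsetD)
  then have "Poly_Mapping.keys h \<subseteq> iso_classes K" by (simp only: carrier_free_Abelian_group_iff)
  then show ?case using inv free_extension_split_relation[OF _ i] by (simp add: free_extension_uminus[OF i])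
next
  case (eng h1 h2)
  then show ?case by (simp add: free_extension_add[OF i])
qed

lemma K0_hom_coset:
  "K0_hom I f (K0_relations K #>\<^bsub>free_Abelian_group (iso_classes K)\<^esub> a) = free_extension I f a"
proof -
  have "free_extension I f (r + a) = free_extension I f a" if "r \<in> K0_relations K" for r
  proof
    fix i show "free_extension I f (r + a) i = free_extension I f a i"
      using free_extension_add[of i I f r a] free_extension_K0_relations[OF that, of i]
      by (cases "i \<in> I") (simp_all add: free_extension_def)
  qed
  moreover have "K0_relations K \<noteq> ({} :: (('p, 'k) umod set \<Rightarrow>\<^sub>0 int) set)"
    unfolding K0_relations_def using generate.one by blast
  ultimately have "free_extension I f ` (K0_relations K #>\<^bsub>free_Abelian_group (iso_classes K)\<^esub> a) = {free_extension I f a}"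
    by (auto simp: r_coset_def image_UN)
  then show ?thesis by (simp add: K0_hom_def)
qed

lemma coset_in_K0_kernel_iff:
  assumes "Poly_Mapping.keys a \<subseteq> iso_classes K"
  shows "K0_relations K #>\<^bsub>free_Abelian_group (iso_classes K)\<^esub> a \<in> K0_kernel K I f
    \<longleftrightarrow> (\<forall>i\<in>I. free_extension I f a i = 0)"
proof -
  have "K0_relations K #>\<^bsub>free_Abelian_group (iso_classes K)\<^esub> a \<in> carrier (K0_split K)"
    using assms unfolding K0_split_def K0_relations_def[symmetric] carrier_FactGroup by (intro imageI) simp
  then show ?thesis
    unfolding K0_kernel_def kernel_def by (auto simp: K0_hom_coset fun_eq_iff free_extension_def)
qed

end

lemma rk_additive_invariant:
  fixes K :: "'k ring"
  shows
  "additive_invariant K (connected_spreads :: 'p::{finite, order} set set) (rk K)"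
proof
  fix L M :: "('p, 'k) umod" and X :: "'p set"
  assume "X \<in> connected_spreads"
  then have ne: "X \<noteq> {}" by (simp add: connected_spreads_def hasse_connected_def)
  assume LM: "is_pmod K L" "is_pmod K M"
  show "iso_on K UNIV L M \<Longrightarrow> rk K L X = rk K M X"
    using LM ne iso_on_subset[of K UNIV L M X] by (intro rk_iso) auto
  fix N :: "('p, 'k) umod"
  assume N: "is_pmod K N"
  show "iso_on K UNIV L (pmod_sum M N) \<Longrightarrow> rk K L X = rk K M X + rk K N X"
    using rk_iso[OF LM(1) pmod_sum_is_pmod[OF LM(2) N] iso_on_subset[OF _ subset_UNIV] finite ne] rk_sum[OF LM(2) N finite ne]
    by simp
qed

lemma dim_Hom_additive_invariant:
  fixes K :: "'k ring"
  shows
  "additive_invariant K (connected_spread_modules K :: ('p::{finite, order}, 'k, 'k) pmod set) (\<lambda>M R. dim_Hom K R M)"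
proof
  fix L M :: "('p, 'k) umod" and R :: "('p, 'k, 'k) pmod"
  assume "R \<in> connected_spread_modules K"
  then obtain S where R: "R = spread_module K S" and S: "order_convex S"
    by (auto simp: connected_spread_modules_def connected_spreads_def intro: is_spread_convex)
  assume LM: "is_pmod K L" "is_pmod K M"
  show "iso_on K UNIV L M \<Longrightarrow> dim_Hom K R L = dim_Hom K R M"
    unfolding R by (rule dim_Hom_iso[OF LM _ S])
  fix N :: "('p, 'k) umod"
  assume N: "is_pmod K N"
  show "iso_on K UNIV L (pmod_sum M N) \<Longrightarrow> dim_Hom K R L = dim_Hom K R M + dim_Hom K R N"
    unfolding R
    using dim_Hom_iso[OF LM(1) pmod_sum_is_pmod[OF LM(2) N] _ S] dim_Hom_sum[OF LM(2) N S] by simp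
qed

section \<open>The separating class\<close>

text \<open>
  The class \<open>a\<close> lies in the kernel of the ranks by \<open>rk_identity\<close>. At the test module \<open>M\<^bsub>C\<^esub>\<close> the dimension of
  homomorphisms takes the value \<open>dim End(M\<^bsub>C\<^esub>) \<noteq> 0\<close> on \<open>a\<close>.
\<close>

theorem (in fork) rk_not_dim_hom_invariant:
  "\<not> dim_hom_invariant K (connected_spread_modules K :: ('p, 'k, 'k) pmod set) (connected_spreads :: 'p set set) (rk K)"
proof
  assume "dim_hom_invariant K (connected_spread_modules K :: ('p, 'k, 'k) pmod set) (connected_spreads :: 'p set set) (rk K)"
  then have kernels: "K0_kernel K (connected_spreads :: 'p set set) (rk K)
      = K0_kernel K (connected_spread_modules K :: ('p, 'k, 'k) pmod set) (\<lambda>M R. dim_Hom K R M)"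
    by (simp add: dim_hom_invariant_def equivalent_invariants_def)
  interpret r: additive_invariant K "connected_spreads :: 'p set set" "rk K" by (rule rk_additive_invariant)
  interpret d: additive_invariant K "connected_spread_modules K :: ('p, 'k, 'k) pmod set" "\<lambda>M R. dim_Hom K R M"
    by (rule dim_Hom_additive_invariant)
  obtain LA :: "('p, 'k) umod" where LA: "is_pmod K LA" "iso_on K UNIV LA (spread_module K A)"
    using inj_const_seq modules(1) by (rule umod_representative)
  obtain LB :: "('p, 'k) umod" where LB: "is_pmod K LB" "iso_on K UNIV LB (spread_module K B)"
    using inj_const_seq modules(2) by (rule umod_representative)
  obtain LC :: "('p, 'k) umod" where LC: "is_pmod K LC" "iso_on K UNIV LC (spread_module K C)"
    using inj_const_seq modules(3) by (rule umod_representative)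
  obtain LS :: "('p, 'k) umod" where LS: "is_pmod K LS" "iso_on K UNIV LS (spread_module K S)"
    using inj_const_seq modules(4) by (rule umod_representative)
  obtain LG :: "('p, 'k) umod" where LG: "is_pmod K LG" "iso_on K UNIV LG G"
    using inj_pair_seq modules(5) by (rule umod_representative)
  define a where "a = frag_of (iso_class K G) + frag_of (iso_class K (spread_module K C))
      - frag_of (iso_class K (spread_module K A)) - frag_of (iso_class K (spread_module K B))
      - frag_of (iso_class K (spread_module K S))"
  let ?cls = "{iso_class K G, iso_class K (spread_module K C), iso_class K (spread_module K A),
      iso_class K (spread_module K B), iso_class K (spread_module K S)}"
  have "?cls \<subseteq> (iso_classes K :: ('p, 'k) umod set set)"
    using iso_class_cong[OF LG(1) modules(5) LG(2)] iso_class_cong[OF LC(1) modules(3) LC(2)]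
      iso_class_cong[OF LA(1) modules(1) LA(2)] iso_class_cong[OF LB(1) modules(2) LB(2)]
      iso_class_cong[OF LS(1) modules(4) LS(2)] LA(1) LB(1) LC(1) LS(1) LG(1)
    unfolding iso_classes_def by (metis (mono_tags, lifting) empty_subsetI image_eqI insert_subset mem_Collect_eq)
  moreover have "Poly_Mapping.keys a \<subseteq> ?cls"
  proof
    fix c assume "c \<in> Poly_Mapping.keys a"
    then show "c \<in> ?cls"
      by (rule contrapos_pp) (simp add: a_def in_keys_iff lookup_minus lookup_add)
  qed
  ultimately have keys: "Poly_Mapping.keys a \<subseteq> (iso_classes K :: ('p, 'k) umod set set)" by blast
  have "free_extension connected_spreads (rk K) a X = 0" if X: "X \<in> connected_spreads" for X
  proof -
    have hX: "hasse_connected X" "order_convex X" "X \<noteq> {}"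
      using X is_spread_convex by (auto simp: connected_spreads_def hasse_connected_def)
    note iso = rk_iso[OF _ _ iso_on_subset[OF _ subset_UNIV] finite hX(3)]
    show ?thesis
      unfolding a_def free_extension_diff[OF X] free_extension_add[OF X]
        r.free_extension_iso_class[OF LG(1) modules(5) LG(2) X] r.free_extension_iso_class[OF LC(1) modules(3) LC(2) X]
        r.free_extension_iso_class[OF LA(1) modules(1) LA(2) X] r.free_extension_iso_class[OF LB(1) modules(2) LB(2) X]
        r.free_extension_iso_class[OF LS(1) modules(4) LS(2) X]
      using rk_identity[OF hX(1,2)]
      by (simp add: iso[OF LG(1) modules(5) LG(2)] iso[OF LC(1) modules(3) LC(2)]
          iso[OF LA(1) modules(1) LA(2)] iso[OF LB(1) modules(2) LB(2)] iso[OF LS(1) modules(4) LS(2)])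
  qed
  then have "K0_relations K #>\<^bsub>free_Abelian_group (iso_classes K)\<^esub> a \<in> K0_kernel K (connected_spreads :: 'p set set) (rk K)"
    using r.coset_in_K0_kernel_iff[OF keys] by blast
  then have zero: "free_extension (connected_spread_modules K) (\<lambda>M R. dim_Hom K R M) a R = 0"
    if "R \<in> connected_spread_modules K" for R :: "('p, 'k, 'k) pmod"
    using kernels d.coset_in_K0_kernel_iff[OF keys] that by blast
  have R: "spread_module K C \<in> connected_spread_modules K"
    unfolding connected_spread_modules_def connected_spreads_def
    using convex_is_spread[OF convex(3)] least_hasse_connected[OF convex(3) p_least(3,5)] by blast
  note iso = dim_Hom_iso[OF _ _ _ convex(3)]
  have "free_extension (connected_spread_modules K) (\<lambda>M R. dim_Hom K R M) a (spread_module K C)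
    = int (dim_Hom K (spread_module K C) (spread_module K C))"
    unfolding a_def free_extension_diff[OF R] free_extension_add[OF R]
      d.free_extension_iso_class[OF LG(1) modules(5) LG(2) R] d.free_extension_iso_class[OF LC(1) modules(3) LC(2) R]
      d.free_extension_iso_class[OF LA(1) modules(1) LA(2) R] d.free_extension_iso_class[OF LB(1) modules(2) LB(2) R]
      d.free_extension_iso_class[OF LS(1) modules(4) LS(2) R]
    by (simp add: iso[OF LG(1) modules(5) LG(2)] iso[OF LC(1) modules(3) LC(2)]
        iso[OF LA(1) modules(1) LA(2)] iso[OF LB(1) modules(2) LB(2)] iso[OF LS(1) modules(4) LS(2)] dim_Hom_C(1-4))
  then show False using zero[OF R] dim_Hom_C(5) by simp
qed

text \<open>
  The points \<open>(1,1) < (1,2)\<close> together with \<open>(1,3)\<close> and \<open>(2,2)\<close> form a fork in the grid, and an order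
  embedding preserves forks.
\<close>

theorem corollary7p9:
  fixes K :: "'k ring"
    and \<iota> :: "nat \<times> nat \<Rightarrow> 'p::{finite, order}"
  assumes "field K"
    and "order_embedding_on grid_2_3 \<iota>"
  shows "\<not> dim_hom_invariant K
             (connected_spread_modules K :: ('p, 'k, 'k) pmod set)
             (connected_spreads :: 'p set set)
             (rk K)"
proof -
  have le: "\<iota> x \<le> \<iota> y \<longleftrightarrow> x \<le> y" if "x \<in> grid_2_3" "y \<in> grid_2_3" for x y
    using assms(2) that by (auto simp: order_embedding_on_def)
  have mem: "(1, 1) \<in> grid_2_3" "(1, 2) \<in> grid_2_3" "(1, 3) \<in> grid_2_3" "(2, 2) \<in> grid_2_3"
    by (auto simp: grid_2_3_def)
  interpret fork K "\<iota> (1, 1)" "\<iota> (1, 2)" "\<iota> (1, 3)" "\<iota> (2, 2)"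
    by (rule fork.intro) (auto simp: le mem less_le_not_le assms(1) simp del: One_nat_def)
  show ?thesis by (rule rk_not_dim_hom_invariant)
qed

end
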